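(* Let $K=\mathbb{C}\{\!\{t\}\!\}$, let $L\ge2$, $\beta\in\mathbb{Q}_{>0}$, and $\lambda_1,\dots,\lambda_L\in\mathbb{C}^*$, with indices taken modulo $L$. Consider, in the $2L$ variables $x_{1,A},\dots,x_{L,A},x_{1,D},\dots,x_{L,D}$, the collision-normalized cross-prism system $$g_{k,A}=(x_{k+1,A}-1)(x_{k+1,D}-1)-\lambda_{k+1}t^\beta,\qquad g_{k,D}=x_{k+1,A}-x_{k+1,D},\qquad k=1,\dots,L.$$ Then the generic fiber (the zero set of the system in $(K^* )^{2L}$) has $2^L$ Puiseux torus branches (points), namely $$x_{k,A}(t)=x_{k,D}(t)=1+\varepsilon_k\sqrt{\lambda_k}\,t^{\beta/2},\qquad \varepsilon_k\in\{+1,-1\},\quad k=1,\dots,L.$$ All these branches have the same valuation vector $v=0$ and the same leading coefficient vector $\mathbf{c}=(1,\dots,1)$. Moreover, the initial fiber at $v=0$ is supported at the unique torus point $(1,\dots,1)\in(\mathbb{C}^* )^{2L}$, with scheme-theoretic length $2^L$. In particular, $m_{\mathrm{cl}}(0)=2^L$.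
   Context: $K=\mathbb{C}\{\!\{t\}\!\}$ is the field of Puiseux series with its usual valuation $\operatorname{val}$ (lowest exponent of $t$); the leading coefficient of $a\in K^*$ is the coefficient of $t^{\operatorname{val}(a)}$. Valuation vectors and leading coefficient vectors of points of $(K^* )^{n}$ are taken coordinatewise. $\sqrt{\lambda_k}$ denotes a fixed complex square root of $\lambda_k$. The cluster multiplicity $m_{\mathrm{cl}}(v)$ is the number of distinct solutions of the system in $(K^* )^{2L}$ whose valuation vector equals $v$. The initial fiber at $v=0$ is the closed subscheme of the torus $(\mathbb{C}^* )^{2L}$ defined by the initial forms $\operatorname{in}_0(g_{k,A})=(x_{k+1,A}-1)(x_{k+1,D}-1)$ and $\operatorname{in}_0(g_{k,D})=x_{k+1,A}-x_{k+1,D}$, $k=1,\dots,L$ (equivalently, by the equations specialized at $t=0$). Here, for $f=\sum_\alpha c_\alpha x^\alpha$, $\operatorname{in}_0(f)$ is the sum of $\operatorname{lc}(c_\alpha)x^\alpha$ over the exponents $\alpha$ with $\operatorname{val}(c_\alpha)$ minimal, where $\operatorname{lc}$ is the leading coefficient. The scheme-theoretic length at a point is the length (equivalently $\mathbb{C}$-dimension) of the local ring of this scheme at the point. *)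

theory Defs
  imports
    "HOL-Computational_Algebra.Formal_Laurent_Series"
    "HOL-Library.Poly_Mapping"
    "HOL-Library.Extended_Nat"
    "HOL-Algebra.QuotRing"
    "HOL-Algebra.Algebraic_Closure_Type"
    "Berlekamp_Zassenhaus.Finite_Field"
begin

section \<open>The field of Puiseux series\<close>

text \<open>
  A formal Puiseux series is a coefficient function on rational exponents whose support has a
  common denominator and is bounded below.
\<close>

definition is_puiseux :: "(rat \<Rightarrow> 'a::zero) \<Rightarrow> bool" where
  "is_puiseux f \<longleftrightarrow>
     (\<exists>n::nat. n > 0 \<and> (\<exists>N::int. \<forall>q. f q \<noteq> 0 \<longrightarrow> (\<exists>k\<ge>N. q = of_int k / of_nat n)))"

typedef (overloaded) 'a puiseux = "{f :: rat \<Rightarrow> 'a::zero. is_puiseux f}"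
  morphisms puiseux_nth Abs_puiseux
  by (rule exI[of _ "\<lambda>_. 0"]) (auto simp: is_puiseux_def)

setup_lifting type_definition_puiseux

text \<open>The raw series \<open>F(t^(1/n))\<close>, for a Laurent series \<open>F\<close>.\<close>

definition fls_root_subst :: "nat \<Rightarrow> 'a::zero fls \<Rightarrow> rat \<Rightarrow> 'a" where
  "fls_root_subst n F q = (if of_nat n * q \<in> \<int> then fls_nth F \<lfloor>of_nat n * q\<rfloor> else 0)"

lemma is_puiseux_fls_root_subst:
  assumes n: "n > 0"
  shows   "is_puiseux (fls_root_subst n F)"
proof -
  have "\<exists>k\<ge>fls_subdegree F. q = of_int k / of_nat n" if q: "fls_root_subst n F q \<noteq> 0" for q
  proof -
    from q have "of_nat n * q \<in> \<int>" by (simp add: fls_root_subst_def split: if_splits)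
    then obtain k where k1: "of_nat n * q = of_int k" by (elim Ints_cases)
    with q have k2: "fls_nth F k \<noteq> 0" by (simp add: fls_root_subst_def)
    from k1 n have "q = of_int k / of_nat n" by (simp add: field_simps)
    with k2 show ?thesis by (intro exI[of _ k]) (auto intro: fls_subdegree_leI)
  qed
  with n show ?thesis unfolding is_puiseux_def by blast
qed

lemma fls_root_subst_of_int: "n > 0 \<Longrightarrow> fls_root_subst n F (of_int k / of_nat n) = fls_nth F k"
  by (simp add: fls_root_subst_def)

lemma is_puiseuxE:
  assumes "is_puiseux f"
  obtains n F where "n > 0" "f = fls_root_subst n F"
proof -
  from assms obtain n N where n: "n > 0"
    and N: "\<And>q. f q \<noteq> 0 \<Longrightarrow> \<exists>k\<ge>N. q = of_int k / of_nat n"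
    unfolding is_puiseux_def by blast
  define F where "F = Abs_fls (\<lambda>k. f (of_int k / of_nat n))"
  have F: "fls_nth F k = f (of_int k / of_nat n)" for k
    unfolding F_def
  proof (rule nth_Abs_fls_lower_bound[of N], intro allI impI)
    fix j assume "j < N"
    show "f (of_int j / of_nat n) = 0"
    proof (rule ccontr)
      assume "f (of_int j / of_nat n) \<noteq> 0"
      then obtain i where "i \<ge> N" "(of_int j / of_nat n :: rat) = of_int i / of_nat n"
        using N by blast
      with n \<open>j < N\<close> show False by simp
    qed
  qed
  have "f q = fls_root_subst n F q" for q
  proof (cases "of_nat n * q \<in> \<int>")
    case True
    then obtain k where "of_nat n * q = of_int k" by (elim Ints_cases)
    hence q: "q = of_int k / of_nat n" using n by (simp add: field_simps)
    show ?thesis unfolding q using n by (simp add: fls_root_subst_of_int F)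
  next
    case False
    have "f q = 0"
    proof (rule ccontr)
      assume "f q \<noteq> 0"
      then obtain k where "q = of_int k / of_nat n" using N by blast
      with n False show False by simp
    qed
    thus ?thesis using False by (simp add: fls_root_subst_def)
  qed
  with n show thesis by (intro that) auto
qed

lemma fls_root_subst_compose_power:
  assumes "n > 0" "m > 0"
  shows   "fls_root_subst (n * m) (fls_compose_power F m) = fls_root_subst n F"
proof
  fix q :: rat
  show "fls_root_subst (n * m) (fls_compose_power F m) q = fls_root_subst n F q"
  proof (cases "of_nat n * q \<in> \<int>")
    case True
    then obtain k where k: "of_nat n * q = of_int k" by (elim Ints_cases)
    hence "of_nat (n * m) * q = of_int (k * int m)"
      by (simp add: mult_ac)
    with k assms show ?thesis
      by (simp only: fls_root_subst_def) (simp add: fls_nth_compose_power del: of_int_mult of_nat_mult)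
  next
    case False
    have "\<not> int m dvd k" if "of_nat (n * m) * q = of_int k" for k
    proof
      assume "int m dvd k"
      then obtain j where "k = int m * j" by (elim dvdE)
      with that have "of_nat m * (of_nat n * q) = of_nat m * (of_int j :: rat)"
        by (simp add: mult_ac)
      hence "of_nat n * q = of_int j" using assms by simp
      with False show False by simp
    qed
    with False assms show ?thesis
      by (auto simp: fls_root_subst_def fls_nth_compose_power simp del: of_nat_mult elim!: Ints_cases)
  qed
qed

lemma common_rootE:
  assumes "is_puiseux f" "is_puiseux g" "is_puiseux h"
  obtains n F G H where "n > 0"
    "f = fls_root_subst n F" "g = fls_root_subst n G" "h = fls_root_subst n H"
proof -
  obtain a F where F: "a > 0" "f = fls_root_subst a F" using assms(1) by (rule is_puiseuxE)
  obtain b G where G: "b > 0" "g = fls_root_subst b G" using assms(2) by (rule is_puiseuxE)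
  obtain c H where H: "c > 0" "h = fls_root_subst c H" using assms(3) by (rule is_puiseuxE)
  have "f = fls_root_subst (a * (b * c)) (fls_compose_power F (b * c))"
    using F G H by (simp add: fls_root_subst_compose_power)
  moreover have "g = fls_root_subst (b * (a * c)) (fls_compose_power G (a * c))"
    using F G H by (simp add: fls_root_subst_compose_power)
  moreover have "h = fls_root_subst (c * (a * b)) (fls_compose_power H (a * b))"
    using F G H by (simp add: fls_root_subst_compose_power)
  ultimately show thesis
    using F(1) G(1) H(1) by (intro that[of "a * b * c"]) (simp_all add: mult_ac)
qed

definition puiseux_conv :: "(rat \<Rightarrow> 'a::field) \<Rightarrow> (rat \<Rightarrow> 'a) \<Rightarrow> rat \<Rightarrow> 'a" where
  "puiseux_conv f g q = (\<Sum>a | f a \<noteq> 0 \<and> g (q - a) \<noteq> 0. f a * g (q - a))"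

lemma puiseux_conv_fls_root_subst:
  assumes n: "n > 0"
  shows "puiseux_conv (fls_root_subst n F) (fls_root_subst n G) = fls_root_subst n (F * G)"
proof
  fix q :: rat
  show "puiseux_conv (fls_root_subst n F) (fls_root_subst n G) q = fls_root_subst n (F * G) q"
  proof (cases "of_nat n * q \<in> \<int>")
    case False
    have "{a. fls_root_subst n F a \<noteq> 0 \<and> fls_root_subst n G (q - a) \<noteq> 0} = {}"
    proof (intro equalityI subsetI)
      fix a assume "a \<in> {a. fls_root_subst n F a \<noteq> 0 \<and> fls_root_subst n G (q - a) \<noteq> 0}"
      hence "of_nat n * a \<in> \<int>" "of_nat n * (q - a) \<in> \<int>"
        by (auto simp: fls_root_subst_def split: if_splits)
      hence "of_nat n * a + of_nat n * (q - a) \<in> \<int>" by (rule Ints_add)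
      with False show "a \<in> {}" by (simp add: algebra_simps)
    qed auto
    thus ?thesis using False
      by (simp only: puiseux_conv_def sum.empty) (simp only: fls_root_subst_def if_False)
  next
    case True
    then obtain k where "of_nat n * q = of_int k" by (elim Ints_cases)
    hence q: "q = of_int k / of_nat n" using n by (simp add: field_simps)
    let ?f = "\<lambda>i::int. of_int i / of_nat n :: rat"
    let ?S = "{i. fls_nth F i \<noteq> 0 \<and> fls_nth G (k - i) \<noteq> 0}"
    have diff: "q - ?f i = ?f (k - i)" for i by (simp add: q diff_divide_distrib)
    have set: "{a. fls_root_subst n F a \<noteq> 0 \<and> fls_root_subst n G (q - a) \<noteq> 0} = ?f ` ?S"
    proof (intro equalityI subsetI)
      fix a assume a: "a \<in> {a. fls_root_subst n F a \<noteq> 0 \<and> fls_root_subst n G (q - a) \<noteq> 0}"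
      hence "of_nat n * a \<in> \<int>" by (auto simp: fls_root_subst_def split: if_splits)
      then obtain i where "of_nat n * a = of_int i" by (elim Ints_cases)
      hence i: "a = ?f i" using n by (simp add: field_simps)
      from a have "i \<in> ?S" unfolding i using n by (simp add: diff fls_root_subst_of_int del: of_int_diff)
      thus "a \<in> ?f ` ?S" using i by blast
    qed (use n in \<open>auto simp only: mem_Collect_eq diff fls_root_subst_of_int\<close>)
    have inj: "inj_on ?f ?S" using n by (auto simp: inj_on_def)
    have "puiseux_conv (fls_root_subst n F) (fls_root_subst n G) q =
            (\<Sum>i\<in>?S. fls_nth F i * fls_nth G (k - i))"
      unfolding puiseux_conv_def set sum.reindex[OF inj]
      using n by (intro sum.cong refl) (simp only: o_def diff fls_root_subst_of_int)
    also have "\<dots> = (\<Sum>i=fls_subdegree F..k - fls_subdegree G. fls_nth F i * fls_nth G (k - i))"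
    proof (rule sum.mono_neutral_left)
      show "?S \<subseteq> {fls_subdegree F..k - fls_subdegree G}"
      proof
        fix i assume "i \<in> ?S"
        hence "fls_subdegree F \<le> i" "fls_subdegree G \<le> k - i"
          by (auto intro: fls_subdegree_leI)
        thus "i \<in> {fls_subdegree F..k - fls_subdegree G}" by simp
      qed
    qed auto
    also have "\<dots> = fls_nth (F * G) k" by (simp add: fls_times_nth(2))
    also have "\<dots> = fls_root_subst n (F * G) q" using n by (simp add: q fls_root_subst_of_int)
    finally show ?thesis .
  qed
qed

lemma fls_root_subst_ring:
  fixes F G :: "'a::field fls"
  shows "(\<lambda>q. fls_root_subst n F q + fls_root_subst n G q) = fls_root_subst n (F + G)"
    and "(\<lambda>q. fls_root_subst n F q - fls_root_subst n G q) = fls_root_subst n (F - G)"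
    and "(\<lambda>q. - fls_root_subst n F q) = fls_root_subst n (- F)"
    and "(\<lambda>_. 0) = fls_root_subst n (0 :: 'a fls)"
    and "n > 0 \<Longrightarrow> (\<lambda>q. if q = 0 then 1 else 0) = fls_root_subst n (1 :: 'a fls)"
  by (auto simp: fls_root_subst_def fun_eq_iff elim!: Ints_cases)

lift_definition puiseux_monom :: "'a::zero \<Rightarrow> rat \<Rightarrow> 'a puiseux" is
  "\<lambda>c r q. if q = r then c else 0"
proof -
  fix c :: 'a and r :: rat
  obtain a b where ab: "quotient_of r = (a, b)" by (cases "quotient_of r")
  have "r = of_int a / of_nat (nat b)" "nat b > 0"
    using quotient_of_div[OF ab] quotient_of_denom_pos[OF ab] by auto
  thus "is_puiseux (\<lambda>q. if q = r then c else 0)"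
    unfolding is_puiseux_def by (intro exI[of _ "nat b"] conjI exI[of _ a]) auto
qed

instantiation puiseux :: (field) comm_ring_1
begin

lift_definition zero_puiseux :: "'a puiseux" is "\<lambda>_. 0"
  by (auto simp: is_puiseux_def)

lift_definition one_puiseux :: "'a puiseux" is "\<lambda>q. if q = 0 then 1 else 0"
  by (subst fls_root_subst_ring(5)[of 1]) (simp_all add: is_puiseux_fls_root_subst)

lift_definition plus_puiseux :: "'a puiseux \<Rightarrow> 'a puiseux \<Rightarrow> 'a puiseux" is
  "\<lambda>f g q. f q + g q"
proof -
  fix f g :: "rat \<Rightarrow> 'a"
  assume "is_puiseux f" "is_puiseux g"
  then obtain n F G where *: "n > 0" "f = fls_root_subst n F" "g = fls_root_subst n G"
    by (metis common_rootE)
  show "is_puiseux (\<lambda>q. f q + g q)"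
    using *(1) by (simp add: *(2,3) fls_root_subst_ring is_puiseux_fls_root_subst)
qed

lift_definition minus_puiseux :: "'a puiseux \<Rightarrow> 'a puiseux \<Rightarrow> 'a puiseux" is
  "\<lambda>f g q. f q - g q"
proof -
  fix f g :: "rat \<Rightarrow> 'a"
  assume "is_puiseux f" "is_puiseux g"
  then obtain n F G where *: "n > 0" "f = fls_root_subst n F" "g = fls_root_subst n G"
    by (metis common_rootE)
  show "is_puiseux (\<lambda>q. f q - g q)"
    using *(1) by (simp add: *(2,3) fls_root_subst_ring is_puiseux_fls_root_subst)
qed

lift_definition uminus_puiseux :: "'a puiseux \<Rightarrow> 'a puiseux" is "\<lambda>f q. - f q"
  by (simp add: is_puiseux_def)

lift_definition times_puiseux :: "'a puiseux \<Rightarrow> 'a puiseux \<Rightarrow> 'a puiseux" is puiseux_conv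
proof -
  fix f g :: "rat \<Rightarrow> 'a"
  assume "is_puiseux f" "is_puiseux g"
  then obtain n F G where *: "n > 0" "f = fls_root_subst n F" "g = fls_root_subst n G"
    by (metis common_rootE)
  show "is_puiseux (puiseux_conv f g)"
    using *(1) by (simp add: *(2,3) puiseux_conv_fls_root_subst is_puiseux_fls_root_subst)
qed

instance
proof
  fix a b c :: "'a puiseux"
  show "a + b + c = a + (b + c)" "a + b = b + a" "0 + a = a" "- a + a = 0" "a - b = a + - b"
    by (transfer; simp add: algebra_simps)+
  show "(0 :: 'a puiseux) \<noteq> 1"
    by transfer (auto simp: fun_eq_iff)
  show "a * b * c = a * (b * c)"
  proof transfer
    fix f g h :: "rat \<Rightarrow> 'a"
    assume "is_puiseux f" "is_puiseux g" "is_puiseux h"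
    then obtain n F G H where *: "n > 0" "f = fls_root_subst n F" "g = fls_root_subst n G"
      "h = fls_root_subst n H" by (rule common_rootE)
    show "puiseux_conv (puiseux_conv f g) h = puiseux_conv f (puiseux_conv g h)"
      using *(1) by (simp add: *(2-4) puiseux_conv_fls_root_subst mult.assoc)
  qed
  show "a * b = b * a"
  proof transfer
    fix f g :: "rat \<Rightarrow> 'a"
    assume "is_puiseux f" "is_puiseux g"
    then obtain n F G where *: "n > 0" "f = fls_root_subst n F" "g = fls_root_subst n G"
      by (metis common_rootE)
    show "puiseux_conv f g = puiseux_conv g f"
      using *(1) by (simp add: *(2,3) puiseux_conv_fls_root_subst mult.commute)
  qed
  show "1 * a = a"
  proof transfer
    fix f :: "rat \<Rightarrow> 'a"
    assume "is_puiseux f"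
    then obtain n F where *: "n > 0" "f = fls_root_subst n F" by (rule is_puiseuxE)
    show "puiseux_conv (\<lambda>q. if q = 0 then 1 else 0) f = f"
      using *(1) by (simp only: *(2) fls_root_subst_ring(5) puiseux_conv_fls_root_subst mult_1)
  qed
  show "(a + b) * c = a * c + b * c"
  proof transfer
    fix f g h :: "rat \<Rightarrow> 'a"
    assume "is_puiseux f" "is_puiseux g" "is_puiseux h"
    then obtain n F G H where *: "n > 0" "f = fls_root_subst n F" "g = fls_root_subst n G"
      "h = fls_root_subst n H" by (rule common_rootE)
    show "puiseux_conv (\<lambda>q. f q + g q) h = (\<lambda>q. puiseux_conv f h q + puiseux_conv g h q)"
      using *(1) by (simp add: *(2-4) fls_root_subst_ring puiseux_conv_fls_root_subst distrib_right)
  qed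
qed

end

lemma puiseux_inverse_exists:
  fixes f :: "'a::field puiseux"
  assumes "f \<noteq> 0"
  shows   "\<exists>g. f * g = 1"
  using assms
proof transfer
  fix f :: "rat \<Rightarrow> 'a"
  assume f: "is_puiseux f" "f \<noteq> (\<lambda>_. 0)"
  from f(1) obtain n F where n: "n > 0" and F: "f = fls_root_subst n F" by (rule is_puiseuxE)
  have "F \<noteq> 0" using f(2) F fls_root_subst_ring(4)[of n] by metis
  hence "puiseux_conv f (fls_root_subst n (inverse F)) = (\<lambda>q. if q = 0 then 1 else 0)"
    using n by (simp add: F puiseux_conv_fls_root_subst fls_root_subst_ring(5)[OF n])
  with n show "\<exists>g\<in>{f. is_puiseux f}. puiseux_conv f g = (\<lambda>q. if q = 0 then 1 else 0)"
    by (intro bexI[of _ "fls_root_subst n (inverse F)"]) (auto simp: is_puiseux_fls_root_subst)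
qed

instantiation puiseux :: (field) field
begin

definition inverse_puiseux :: "'a puiseux \<Rightarrow> 'a puiseux" where
  "inverse_puiseux f = (if f = 0 then 0 else SOME g. f * g = 1)"

definition divide_puiseux :: "'a puiseux \<Rightarrow> 'a puiseux \<Rightarrow> 'a puiseux" where
  "divide_puiseux f g = f * inverse g"

instance
proof
  fix f g :: "'a puiseux"
  show "inverse f * f = 1" if "f \<noteq> 0"
    using someI_ex[OF puiseux_inverse_exists[OF that]] that
    by (simp add: inverse_puiseux_def mult.commute)
qed (simp_all add: inverse_puiseux_def divide_puiseux_def)

end

text \<open>Both of the following are meaningful for nonzero series only.\<close>

definition puiseux_val :: "'a::zero puiseux \<Rightarrow> rat" where
  "puiseux_val f = (LEAST q. puiseux_nth f q \<noteq> 0)"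

definition puiseux_lc :: "'a::zero puiseux \<Rightarrow> 'a" where
  "puiseux_lc f = puiseux_nth f (puiseux_val f)"


section \<open>Laurent polynomials and torus points\<close>

text \<open>
  An element of \<open>'v \<Rightarrow>\<^sub>0 int\<close> is the exponent vector of a Laurent monomial in the variables \<open>'v\<close>;
  multiplication on \<open>laurent\<close> is the convolution product of \<^theory>\<open>HOL-Library.Poly_Mapping\<close>.
\<close>

type_synonym ('v, 'k) laurent = "('v \<Rightarrow>\<^sub>0 int) \<Rightarrow>\<^sub>0 'k"

definition laurent_const :: "'k::zero \<Rightarrow> ('v, 'k) laurent" where
  "laurent_const c = Poly_Mapping.single 0 c"

definition laurent_var :: "'v \<Rightarrow> ('v, 'k::zero_neq_one) laurent" where
  "laurent_var i = Poly_Mapping.single (Poly_Mapping.single i 1) 1"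

definition laurent_eval :: "('v::finite, 'k::field) laurent \<Rightarrow> ('v \<Rightarrow> 'k) \<Rightarrow> 'k" where
  "laurent_eval f x =
     (\<Sum>\<alpha>\<in>Poly_Mapping.keys f.
        Poly_Mapping.lookup f \<alpha> * (\<Prod>i\<in>UNIV. x i powi Poly_Mapping.lookup \<alpha> i))"

definition torus_zeros :: "('v::finite, 'k::field) laurent set \<Rightarrow> ('v \<Rightarrow> 'k) set" where
  "torus_zeros F = {x. (\<forall>i. x i \<noteq> 0) \<and> (\<forall>f\<in>F. laurent_eval f x = 0)}"

definition val_vector :: "('v \<Rightarrow> 'a::zero puiseux) \<Rightarrow> 'v \<Rightarrow> rat" where
  "val_vector x = (\<lambda>i. puiseux_val (x i))"

definition lc_vector :: "('v \<Rightarrow> 'a::zero puiseux) \<Rightarrow> 'v \<Rightarrow> 'a" where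
  "lc_vector x = (\<lambda>i. puiseux_lc (x i))"

definition cluster_mult ::
    "('v::finite, 'a::field puiseux) laurent set \<Rightarrow> ('v \<Rightarrow> rat) \<Rightarrow> nat" where
  "cluster_mult F v = card {x \<in> torus_zeros F. val_vector x = v}"

definition init_form :: "('v, 'a::field puiseux) laurent \<Rightarrow> ('v, 'a) laurent" where
  "init_form f =
     (\<Sum>\<alpha> | \<alpha> \<in> Poly_Mapping.keys f \<and>
             (\<forall>\<gamma>\<in>Poly_Mapping.keys f.
                puiseux_val (Poly_Mapping.lookup f \<alpha>) \<le> puiseux_val (Poly_Mapping.lookup f \<gamma>)).
        Poly_Mapping.single \<alpha> (puiseux_lc (Poly_Mapping.lookup f \<alpha>)))"


section \<open>Affine schemes: points, local rings, length\<close>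

definition ring_spec :: "('a, 'm) ring_scheme \<Rightarrow> 'a set set" where
  "ring_spec R = {P. primeideal P R}"

definition loc_rel ::
    "('a, 'm) ring_scheme \<Rightarrow> 'a set \<Rightarrow> (('a \<times> 'a) \<times> ('a \<times> 'a)) set" where
  "loc_rel R P =
     {((a, s), (b, u)). a \<in> carrier R \<and> b \<in> carrier R \<and> s \<in> carrier R - P \<and> u \<in> carrier R - P \<and>
        (\<exists>w\<in>carrier R - P. w \<otimes>\<^bsub>R\<^esub> (a \<otimes>\<^bsub>R\<^esub> u) = w \<otimes>\<^bsub>R\<^esub> (b \<otimes>\<^bsub>R\<^esub> s))}"

definition loc_frac :: "('a, 'm) ring_scheme \<Rightarrow> 'a set \<Rightarrow> 'a \<Rightarrow> 'a \<Rightarrow> ('a \<times> 'a) set" where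
  "loc_frac R P a s = loc_rel R P `` {(a, s)}"

definition localization :: "('a, 'm) ring_scheme \<Rightarrow> 'a set \<Rightarrow> ('a \<times> 'a) set ring" where
  "localization R P =
     \<lparr>carrier = (carrier R \<times> (carrier R - P)) // loc_rel R P,
      monoid.mult = (\<lambda>p q. \<Union>(a, s)\<in>p. \<Union>(b, u)\<in>q. loc_frac R P (a \<otimes>\<^bsub>R\<^esub> b) (s \<otimes>\<^bsub>R\<^esub> u)),
      one = loc_frac R P \<one>\<^bsub>R\<^esub> \<one>\<^bsub>R\<^esub>,
      zero = loc_frac R P \<zero>\<^bsub>R\<^esub> \<one>\<^bsub>R\<^esub>,
      add = (\<lambda>p q. \<Union>(a, s)\<in>p. \<Union>(b, u)\<in>q.
               loc_frac R P (a \<otimes>\<^bsub>R\<^esub> u \<oplus>\<^bsub>R\<^esub> b \<otimes>\<^bsub>R\<^esub> s) (s \<otimes>\<^bsub>R\<^esub> u))\<rparr>"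

text \<open>
  Length of a commutative ring as a module over itself: the supremum of the lengths of strict
  chains of submodules, i.e. of ideals.
\<close>

definition ring_length :: "('a, 'm) ring_scheme \<Rightarrow> enat" where
  "ring_length R =
     (SUP n \<in> {n. \<exists>J. (\<forall>i\<le>n. ideal (J i) R) \<and> (\<forall>i<n. J i \<subset> J (Suc i))}. enat n)"


section \<open>The initial fiber at 0\<close>

text \<open>
  The initial fiber is the closed subscheme of the torus cut out by the initial forms of the
  given generators, i.e. the spectrum of \<open>init_fiber_ring\<close>.
\<close>

definition init_fiber_ideal ::
    "('v, 'a::field puiseux) laurent set \<Rightarrow> ('v, 'a) laurent set" where
  "init_fiber_ideal F = genideal ring_of_type_algebra (init_form ` F)"

definition init_fiber_ring ::
    "('v, 'a::field puiseux) laurent set \<Rightarrow> ('v, 'a) laurent set ring" where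
  "init_fiber_ring F = ring_of_type_algebra Quot init_fiber_ideal F"

text \<open>
  The image in \<open>init_fiber_ring F\<close> of the maximal ideal of the torus point \<open>p\<close>; this is a point
  of the initial fiber whenever \<open>p\<close> is a zero of all the initial forms.
\<close>

definition init_fiber_point ::
    "('v::finite, 'a::field puiseux) laurent set \<Rightarrow> ('v \<Rightarrow> 'a) \<Rightarrow> ('v, 'a) laurent set set" where
  "init_fiber_point F p =
     (\<lambda>f. init_fiber_ideal F +>\<^bsub>ring_of_type_algebra\<^esub> f) ` {f. laurent_eval f p = 0}"

definition init_fiber_length_at ::
    "('v::finite, 'a::field puiseux) laurent set \<Rightarrow> ('v \<Rightarrow> 'a) \<Rightarrow> enat" where
  "init_fiber_length_at F p = ring_length (localization (init_fiber_ring F) (init_fiber_point F p))"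


section \<open>The collision-normalized cross-prism system\<close>

text \<open>
  The integers modulo \<open>L\<close> are the type \<open>'l mod_ring\<close> with \<open>L = CARD('l)\<close>; the class \<open>nontriv\<close>
  says \<open>L \<ge> 2\<close>. The index \<open>L\<close> is the element \<open>0\<close>.
\<close>

datatype side = Side_A | Side_D

instance side :: finite
proof
  have "(UNIV :: side set) \<subseteq> {Side_A, Side_D}" by (auto intro: side.exhaust)
  thus "finite (UNIV :: side set)" by (rule finite_subset) simp
qed

type_synonym 'l prism_var = "'l mod_ring \<times> side"

definition prism_gA ::
    "('l::nontriv mod_ring \<Rightarrow> complex) \<Rightarrow> rat \<Rightarrow> 'l mod_ring \<Rightarrow>
     ('l prism_var, complex puiseux) laurent" where
  "prism_gA lam \<beta> k =
     (laurent_var (k + 1, Side_A) - 1) * (laurent_var (k + 1, Side_D) - 1)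
       - laurent_const (puiseux_monom (lam (k + 1)) \<beta>)"

definition prism_gD :: "'l::nontriv mod_ring \<Rightarrow> ('l prism_var, complex puiseux) laurent" where
  "prism_gD k = laurent_var (k + 1, Side_A) - laurent_var (k + 1, Side_D)"

definition prism_system ::
    "('l::nontriv mod_ring \<Rightarrow> complex) \<Rightarrow> rat \<Rightarrow> ('l prism_var, complex puiseux) laurent set" where
  "prism_system lam \<beta> = range (prism_gA lam \<beta>) \<union> range prism_gD"

text \<open>Here \<open>s k\<close> is the chosen square root of \<open>lam k\<close>.\<close>

definition prism_branch ::
    "('l::nontriv mod_ring \<Rightarrow> complex) \<Rightarrow> rat \<Rightarrow> ('l mod_ring \<Rightarrow> complex) \<Rightarrow>
     'l prism_var \<Rightarrow> complex puiseux" where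
  "prism_branch s \<beta> \<epsilon> = (\<lambda>(k, _). 1 + puiseux_monom (\<epsilon> k * s k) (\<beta> / 2))"

end

theory Submission
  imports Defs "HOL-Analysis.Cartesian_Space"
begin

text \<open>
  The equations decouple into \<open>L\<close> independent pairs, one for each index \<open>k\<close>. Substituting
  \<open>x\<^sub>k\<^sub>,\<^sub>D = x\<^sub>k\<^sub>,\<^sub>A\<close> leaves \<open>(x\<^sub>k\<^sub>,\<^sub>A - 1)\<^sup>2 = \<lambda>\<^sub>k t\<^sup>\<beta>\<close>, which has the two roots
  \<open>1 \<plusminus> \<surd>\<lambda>\<^sub>k t\<^bsup>\<beta>/2\<^esup>\<close> in the field of Puiseux series. This gives the \<open>2\<^sup>L\<close> branches, and since \<open>\<beta> > 0\<close>
  each coordinate has constant term \<open>1\<close> and hence valuation \<open>0\<close> and leading coefficient \<open>1\<close>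
  (\<open>torus_zeros_prism_system\<close>, \<open>card_prism_branches\<close>, \<open>prism_branch_val_lc\<close>).

  At \<open>t = 0\<close> the branches collide. With \<open>y\<^sub>k = x\<^sub>k\<^sub>,\<^sub>A - 1\<close> the coordinate ring of the initial fiber is
  \<open>\<complex>[y\<^sub>1, \<dots>, y\<^sub>L]/(y\<^sub>1\<^sup>2, \<dots>, y\<^sub>L\<^sup>2)\<close>: a local ring whose basis consists of the \<open>2\<^sup>L\<close> squarefree
  monomials. Instead of constructing this algebra, the proof describes the coordinates in that basis
  as linear functionals on Laurent polynomials. The functional \<open>jet S\<close> weights a monomial by the
  product, over \<open>k\<close> in \<open>S\<close>, of its total degrees in \<open>x\<^sub>k\<^sub>,\<^sub>A\<close> and \<open>x\<^sub>k\<^sub>,\<^sub>D\<close>. The Leibniz rule \<open>jet_mult\<close>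
  and the Taylor expansion \<open>taylor_cong_mod\<close> show that the initial ideal is the common kernel of the
  jets (\<open>mem_cross_ideal_iff\<close>).

  The remaining claims follow from this description. A function that does not vanish at
  \<open>(1, \<dots>, 1)\<close> is a unit modulo the initial ideal (\<open>unit_mod_cross_ideal\<close>), and the
  maximal ideal of this point is the only prime (\<open>prime_eq_base_point\<close>). Hence localizing there
  changes nothing, and the length is the maximal length of a chain of ideals of Laurent polynomials above the initial
  ideal (\<open>ring_length_localization_at_units\<close>, \<open>ring_length_surj\<close>). It is at most \<open>2\<^sup>L\<close> by comparing
  dimensions (\<open>cross_chain_length_le\<close>), and a chain of that length is obtained by dropping the
  conditions \<open>jet S f = 0\<close> one after another, larger sets first (\<open>cross_chain_exists\<close>).
\<close>

section \<open>Linear functionals on Laurent polynomials\<close>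

text \<open>
  Evaluation at a torus point and all the Taylor functionals used below have this shape, for
  different weights on the exponents. A weight that obeys an addition formula in the exponent
  yields a multiplication formula for the functional.
\<close>

definition weighted_sum :: "(('v \<Rightarrow>\<^sub>0 int) \<Rightarrow> 'k::comm_ring_1) \<Rightarrow> ('v, 'k) laurent \<Rightarrow> 'k" where
  "weighted_sum w f = (\<Sum>\<alpha>\<in>Poly_Mapping.keys f. Poly_Mapping.lookup f \<alpha> * w \<alpha>)"

lemma weighted_sum_superset:
  assumes "finite A" "Poly_Mapping.keys f \<subseteq> A"
  shows "weighted_sum w f = (\<Sum>\<alpha>\<in>A. Poly_Mapping.lookup f \<alpha> * w \<alpha>)"
  unfolding weighted_sum_def using assms
  by (intro sum.mono_neutral_left) (auto simp: in_keys_iff)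

lemma weighted_sum_single: "weighted_sum w (Poly_Mapping.single \<alpha> c) = c * w \<alpha>"
  by (subst weighted_sum_superset[of "{\<alpha>}"]) auto

lemma weighted_sum_add: "weighted_sum w (f + g) = weighted_sum w f + weighted_sum w g"
proof -
  let ?A = "Poly_Mapping.keys f \<union> Poly_Mapping.keys g"
  have "finite ?A" "Poly_Mapping.keys (f + g) \<subseteq> ?A" by (auto simp: Poly_Mapping.keys_add)
  thus ?thesis
    by (simp add: weighted_sum_superset[of ?A] lookup_add algebra_simps sum.distrib)
qed

lemma weighted_sum_zero: "weighted_sum w 0 = 0"
  by (simp add: weighted_sum_def)

lemma weighted_sum_minus: "weighted_sum w (f - g) = weighted_sum w f - weighted_sum w g"
  using weighted_sum_add[of w "f - g" g] by simp

lemma laurent_induct [case_names single add]: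
  fixes f :: "('v, 'k::comm_ring_1) laurent"
  assumes single: "\<And>\<alpha> c. P (Poly_Mapping.single \<alpha> c)"
    and add: "\<And>f g. P f \<Longrightarrow> P g \<Longrightarrow> P (f + g)"
  shows "P f"
proof -
  have f: "f = (\<Sum>\<alpha>\<in>Poly_Mapping.keys f. Poly_Mapping.single \<alpha> (Poly_Mapping.lookup f \<alpha>))"
    by (rule poly_mapping_eqI)
      (auto simp: lookup_sum lookup_single when_def not_in_keys_iff_lookup_eq_zero)
  have "P (\<Sum>\<alpha>\<in>A. Poly_Mapping.single \<alpha> (Poly_Mapping.lookup f \<alpha>))" for A
    using single[of 0 0]
    by (induction A rule: infinite_finite_induct) (auto intro: single add)
  with f show ?thesis by metis
qed

text \<open>
  Both sides are additive in \<open>f\<close> and in \<open>g\<close>, so only single monomials have to be compared. The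
  index set \<open>I\<close> is a singleton for evaluations, whose weights are multiplicative, and a power set
  for jets.
\<close>

lemma weighted_sum_mult:
  assumes w: "\<And>\<alpha> \<beta>. w (\<alpha> + \<beta>) = (\<Sum>T\<in>I. u T \<alpha> * v T \<beta>)"
  shows "weighted_sum w (f * g) = (\<Sum>T\<in>I. weighted_sum (u T) f * weighted_sum (v T) g)"
proof (induction f rule: laurent_induct)
  case (single \<alpha> c)
  show ?case
  proof (induction g rule: laurent_induct)
    case (single \<beta> d)
    show ?case
      by (simp add: mult_single weighted_sum_single w sum_distrib_left mult_ac)
  qed (simp add: ring_distribs weighted_sum_add sum.distrib)
qed (simp add: ring_distribs weighted_sum_add sum.distrib)

lemma laurent_one: "1 = (Poly_Mapping.single 0 1 :: ('v, 'k::comm_ring_1) laurent)"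
  by simp

lemma laurent_eval_eq_weighted_sum:
  "laurent_eval f x = weighted_sum (\<lambda>\<alpha>. \<Prod>i\<in>UNIV. x i powi Poly_Mapping.lookup \<alpha> i) f"
  by (simp add: laurent_eval_def weighted_sum_def)

lemma laurent_eval_simps:
  fixes x :: "'v::finite \<Rightarrow> 'k::field"
  shows "laurent_eval (f - g) x = laurent_eval f x - laurent_eval g x"
    and "laurent_eval (laurent_const c) x = c"
    and "laurent_eval 1 x = 1"
  unfolding laurent_one laurent_const_def
  by (simp_all only: laurent_eval_eq_weighted_sum weighted_sum_minus weighted_sum_single) simp_all

lemma laurent_eval_mult:
  fixes x :: "'v::finite \<Rightarrow> 'k::field"
  assumes "\<And>i. x i \<noteq> 0"
  shows "laurent_eval (f * g) x = laurent_eval f x * laurent_eval g x"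
  using weighted_sum_mult[where w = "\<lambda>\<alpha>. \<Prod>i\<in>UNIV. x i powi Poly_Mapping.lookup \<alpha> i" and I = "{()}"
      and u = "\<lambda>_ \<alpha>. \<Prod>i\<in>UNIV. x i powi Poly_Mapping.lookup \<alpha> i"
      and v = "\<lambda>_ \<alpha>. \<Prod>i\<in>UNIV. x i powi Poly_Mapping.lookup \<alpha> i"]
  by (simp add: laurent_eval_eq_weighted_sum lookup_add power_int_add assms prod.distrib)

lemma laurent_eval_var:
  fixes x :: "'v::finite \<Rightarrow> 'k::field"
  shows "laurent_eval (laurent_var i) x = x i"
proof -
  have "(\<Prod>j\<in>UNIV. x j powi (if j = i then 1 else 0)) = (\<Prod>j\<in>UNIV. if j = i then x j else 1)"
    by (rule prod.cong) auto
  thus ?thesis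
    by (simp add: laurent_eval_eq_weighted_sum laurent_var_def weighted_sum_single lookup_single when_def eq_commute[of i])
qed

section \<open>Puiseux series and initial forms\<close>

lemma puiseux_monom_mult: "puiseux_monom a p * puiseux_monom b q = puiseux_monom (a * b) (p + q)"
proof transfer
  fix a b :: 'a and p q :: rat
  show "puiseux_conv (\<lambda>r. if r = p then a else 0) (\<lambda>r. if r = q then b else 0)
        = (\<lambda>r. if r = p + q then a * b else 0)"
  proof
    fix r
    have "{c. (if c = p then a else 0) \<noteq> 0 \<and> (if r - c = q then b else 0) \<noteq> 0}
        = (if r = p + q \<and> a \<noteq> 0 \<and> b \<noteq> 0 then {p} else {})"
      by (auto simp: algebra_simps)
    thus "puiseux_conv (\<lambda>r. if r = p then a else 0) (\<lambda>r. if r = q then b else 0) r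
        = (if r = p + q then a * b else 0)"
      by (auto simp: puiseux_conv_def)
  qed
qed

lemma puiseux_nth_monom: "puiseux_nth (puiseux_monom c r) q = (if q = r then c else 0)"
  by transfer simp

lemma puiseux_nth_simps:
  fixes f g :: "'a::field puiseux"
  shows "puiseux_nth 0 q = (0::'a)"
    and "puiseux_nth 1 q = (if q = 0 then 1 else (0::'a))"
    and "puiseux_nth (f + g) q = puiseux_nth f q + puiseux_nth g q"
    and "puiseux_nth (f - g) q = puiseux_nth f q - puiseux_nth g q"
    and "puiseux_nth (- f) q = - puiseux_nth f q"
  by (transfer; simp)+

lemma puiseux_val_lc_eqI:
  assumes "puiseux_nth f r \<noteq> 0" "\<And>q. q < r \<Longrightarrow> puiseux_nth f q = 0"
  shows "puiseux_val f = r" "puiseux_lc f = puiseux_nth f r"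
proof -
  show "puiseux_val f = r"
    unfolding puiseux_val_def using assms by (intro Least_equality) (auto simp: not_less[symmetric])
  thus "puiseux_lc f = puiseux_nth f r" by (simp add: puiseux_lc_def)
qed

text \<open>
  When all coefficients have valuation \<open>0\<close>, every term is minimal and the initial form is the
  specialization at \<open>t = 0\<close>. All generators of the system are of this kind.
\<close>

lemma lookup_init_form_val_0:
  fixes f :: "('v, 'a::field puiseux) laurent"
  assumes "\<And>\<alpha>. \<alpha> \<in> Poly_Mapping.keys f \<Longrightarrow> puiseux_val (Poly_Mapping.lookup f \<alpha>) = 0"
  shows "Poly_Mapping.lookup (init_form f) \<alpha> = puiseux_nth (Poly_Mapping.lookup f \<alpha>) 0"
proof -
  have "init_form f = (\<Sum>\<alpha>\<in>Poly_Mapping.keys f.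
      Poly_Mapping.single \<alpha> (puiseux_nth (Poly_Mapping.lookup f \<alpha>) 0))"
    unfolding init_form_def using assms by (intro sum.cong) (auto simp: puiseux_lc_def)
  thus ?thesis
    by (auto simp: lookup_sum lookup_single when_def in_keys_iff puiseux_nth_simps)
qed

abbreviation exponent :: "'v \<Rightarrow> 'v \<Rightarrow>\<^sub>0 int" where
  "exponent v \<equiv> Poly_Mapping.single v 1"

lemma single_add_single_neq:
  assumes "v \<noteq> w"
  shows "exponent v + exponent w \<noteq> 0" "exponent v + exponent w \<noteq> exponent v"
    "exponent v + exponent w \<noteq> exponent w" "exponent v \<noteq> exponent w" "exponent v \<noteq> 0"
  using assms by (auto simp: poly_mapping_eq_iff fun_eq_iff lookup_add lookup_single when_def)

text \<open>
  Since \<open>\<beta> > 0\<close>, the constant coefficient \<open>1 - c t\<^sup>\<beta>\<close> is still a unit with leading coefficient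
  \<open>1\<close>, so the deformation term disappears from the initial form.
\<close>

lemma init_form_cross:
  fixes v w :: 'v and c :: "'a::field" and \<beta> :: rat
  assumes "v \<noteq> w" "\<beta> > 0"
  shows "init_form ((laurent_var v - 1) * (laurent_var w - 1) - laurent_const (puiseux_monom c \<beta>))
       = (laurent_var v - 1) * (laurent_var w - 1)" (is "init_form ?f = ?g")
proof (rule poly_mapping_eqI)
  fix \<alpha> :: "'v \<Rightarrow>\<^sub>0 int"
  note neq = single_add_single_neq[OF assms(1)]
  have f: "?f = Poly_Mapping.single (exponent v + exponent w) 1 - Poly_Mapping.single (exponent v) 1
      - Poly_Mapping.single (exponent w) 1 + Poly_Mapping.single 0 (1 - puiseux_monom c \<beta>)"
    by (simp add: laurent_var_def laurent_const_def algebra_simps mult_single single_diff)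
  have g: "?g = Poly_Mapping.single (exponent v + exponent w) 1 - Poly_Mapping.single (exponent v) 1
      - Poly_Mapping.single (exponent w) 1 + Poly_Mapping.single 0 1"
    by (simp add: laurent_var_def laurent_const_def algebra_simps mult_single single_diff)
  have "puiseux_val (Poly_Mapping.lookup ?f \<alpha>) = 0" if "\<alpha> \<in> Poly_Mapping.keys ?f" for \<alpha>
  proof -
    have "Poly_Mapping.lookup ?f \<alpha> \<in> {0, 1, -1, 1 - puiseux_monom c \<beta>}"
      unfolding f using neq by (auto simp: lookup_add lookup_minus lookup_single when_def)
    with that have "Poly_Mapping.lookup ?f \<alpha> \<in> {1, -1, 1 - puiseux_monom c \<beta>}"
      by (auto simp: in_keys_iff)
    thus ?thesis using assms(2)
      by (intro puiseux_val_lc_eqI(1)) (auto simp: puiseux_nth_simps puiseux_nth_monom)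
  qed
  hence "Poly_Mapping.lookup (init_form ?f) \<alpha> = puiseux_nth (Poly_Mapping.lookup ?f \<alpha>) 0"
    by (rule lookup_init_form_val_0)
  also have "\<dots> = Poly_Mapping.lookup ?g \<alpha>"
    unfolding f g using assms(2)
    by (simp add: lookup_add lookup_minus lookup_single lookup_one when_def
        puiseux_nth_simps puiseux_nth_monom)
  finally show "Poly_Mapping.lookup (init_form ?f) \<alpha> = Poly_Mapping.lookup ?g \<alpha>" .
qed

lemma init_form_var_diff:
  fixes v w :: 'v
  assumes "v \<noteq> w"
  shows "init_form (laurent_var v - laurent_var w :: ('v, 'a::field puiseux) laurent)
       = laurent_var v - laurent_var w" (is "init_form ?f = _")
proof (rule poly_mapping_eqI)
  fix \<alpha> :: "'v \<Rightarrow>\<^sub>0 int"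
  note neq = single_add_single_neq[OF assms(1)]
  have "puiseux_val (Poly_Mapping.lookup ?f \<alpha>) = 0" if "\<alpha> \<in> Poly_Mapping.keys ?f" for \<alpha>
  proof -
    have "Poly_Mapping.lookup ?f \<alpha> \<in> {0, 1, -1}"
      using neq by (auto simp: laurent_var_def lookup_minus lookup_single when_def)
    with that have "Poly_Mapping.lookup ?f \<alpha> \<in> {1, -1}"
      by (auto simp: in_keys_iff)
    thus ?thesis
      by (intro puiseux_val_lc_eqI(1)) (auto simp: puiseux_nth_simps)
  qed
  hence "Poly_Mapping.lookup (init_form ?f) \<alpha> = puiseux_nth (Poly_Mapping.lookup ?f \<alpha>) 0"
    by (rule lookup_init_form_val_0)
  thus "Poly_Mapping.lookup (init_form ?f) \<alpha> = Poly_Mapping.lookup (laurent_var v - laurent_var w) \<alpha>"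
    by (simp add: laurent_var_def lookup_minus lookup_single when_def puiseux_nth_simps)
qed

section \<open>The branches of the cross-prism system\<close>

text \<open>
  Substituting \<open>x\<^sub>D = x\<^sub>A\<close> turns a pair of equations of the system into \<open>(x - 1)\<^sup>2 = c t\<^sup>\<beta>\<close>, and
  \<open>c t\<^sup>\<beta>\<close> is the square of \<open>s t\<^bsup>\<beta>/2\<^esup>\<close>; in a field this leaves exactly the two roots \<open>\<plusminus> s t\<^bsup>\<beta>/2\<^esup>\<close>.
\<close>

lemma puiseux_square_root:
  fixes x :: "'a::field puiseux"
  assumes "s ^ 2 = c"
  shows "(x - 1) * (x - 1) = puiseux_monom c \<beta> \<longleftrightarrow>
    (\<exists>e\<in>{1, -1}. x = 1 + puiseux_monom (e * s) (\<beta> / 2))"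
proof -
  have "puiseux_monom c \<beta> = puiseux_monom s (\<beta> / 2) ^ 2"
    using assms by (simp add: power2_eq_square puiseux_monom_mult)
  moreover have "puiseux_monom (- s) (\<beta> / 2) = - puiseux_monom s (\<beta> / 2)"
    by transfer auto
  ultimately show ?thesis
    by (auto simp: power2_eq_square[symmetric] power2_eq_iff algebra_simps)
qed

lemma surj_plus_one: "surj (\<lambda>k. k + 1 :: 'a::ring_1)"
  by (metis surjI diff_add_cancel)

lemma torus_zeros_prism_system:
  fixes lam s :: "'l::nontriv mod_ring \<Rightarrow> complex"
  assumes "\<beta> > 0" "\<And>k. s k ^ 2 = lam k"
  shows "torus_zeros (prism_system lam \<beta>) = {prism_branch s \<beta> \<epsilon> | \<epsilon>. \<forall>k. \<epsilon> k \<in> {1, -1}}"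
proof (intro equalityI subsetI)
  fix x assume x: "x \<in> torus_zeros (prism_system lam \<beta>)"
  hence nz: "\<And>i. x i \<noteq> 0" by (auto simp: torus_zeros_def)
  note ev = laurent_eval_simps laurent_eval_var laurent_eval_mult[OF nz]
  from x have "\<forall>k. laurent_eval (prism_gD (k::'l mod_ring)) x = 0" "\<forall>k. laurent_eval (prism_gA lam \<beta> k) x = 0"
    by (auto simp: torus_zeros_def prism_system_def)
  hence D: "x (k + 1, Side_A) = x (k + 1, Side_D)"
    and A: "(x (k + 1, Side_A) - 1) * (x (k + 1, Side_D) - 1) = puiseux_monom (lam (k + 1)) \<beta>" for k
    by (simp_all add: prism_gA_def prism_gD_def ev)
  \<comment> \<open>the equations carry the index \<open>k + 1\<close>, which runs through all residues as \<open>k\<close> does\<close>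
  have D': "x (k, Side_A) = x (k, Side_D)" for k
    using D[of "k - 1"] by simp
  have "(x (k, Side_A) - 1) * (x (k, Side_A) - 1) = puiseux_monom (lam k) \<beta>" for k
    using A[of "k - 1"] D'[of k] by simp
  hence "\<exists>e\<in>{1, -1}. x (k, Side_A) = 1 + puiseux_monom (e * s k) (\<beta> / 2)" for k
    using puiseux_square_root[OF assms(2), of "x (k, Side_A)"] by blast
  then obtain \<epsilon> where \<epsilon>: "\<And>k. \<epsilon> k \<in> {1, -1}"
    "\<And>k. x (k, Side_A) = 1 + puiseux_monom (\<epsilon> k * s k) (\<beta> / 2)" by metis
  have "x = prism_branch s \<beta> \<epsilon>"
  proof
    fix i show "x i = prism_branch s \<beta> \<epsilon> i"
      using \<epsilon>(2) D' by (cases i; cases "snd i") (auto simp: prism_branch_def)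
  qed
  with \<epsilon>(1) show "x \<in> {prism_branch s \<beta> \<epsilon> | \<epsilon>. \<forall>k. \<epsilon> k \<in> {1, -1}}" by blast
next
  fix x assume "x \<in> {prism_branch s \<beta> \<epsilon> | \<epsilon>. \<forall>k. \<epsilon> k \<in> {1, -1}}"
  then obtain \<epsilon> where \<epsilon>: "\<And>k. \<epsilon> k \<in> {1, -1}" and x: "x = prism_branch s \<beta> \<epsilon>" by blast
  have xk: "x (k, b) = 1 + puiseux_monom (\<epsilon> k * s k) (\<beta> / 2)" for k b
    by (simp add: x prism_branch_def)
  have nz: "x i \<noteq> 0" for i
  proof -
    have "puiseux_nth (x i) 0 = 1"
      using assms(1) by (cases i) (simp add: xk puiseux_nth_simps puiseux_nth_monom)
    thus ?thesis by (auto simp: puiseux_nth_simps)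
  qed
  have "(x (k, Side_A) - 1) * (x (k, Side_A) - 1) = puiseux_monom (lam k) \<beta>" for k
    using puiseux_square_root[OF assms(2), of "x (k, Side_A)"] \<epsilon>(1) xk by blast
  hence "laurent_eval (prism_gA lam \<beta> k) x = 0" "laurent_eval (prism_gD k) x = 0" for k
    by (simp_all add: prism_gA_def prism_gD_def laurent_eval_simps laurent_eval_var
        laurent_eval_mult[OF nz] xk)
  with nz show "x \<in> torus_zeros (prism_system lam \<beta>)"
    by (auto simp: torus_zeros_def prism_system_def)
qed

lemma prism_branch_val_lc:
  assumes "\<beta> > 0"
  shows "val_vector (prism_branch s \<beta> \<epsilon>) = (\<lambda>_. 0)" "lc_vector (prism_branch s \<beta> \<epsilon>) = (\<lambda>_. 1)"
proof -
  have "puiseux_val (prism_branch s \<beta> \<epsilon> i) = 0 \<and> puiseux_lc (prism_branch s \<beta> \<epsilon> i) = 1" for i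
    using puiseux_val_lc_eqI[of "prism_branch s \<beta> \<epsilon> i" 0] assms
    by (cases i) (auto simp: prism_branch_def puiseux_nth_simps puiseux_nth_monom)
  thus "val_vector (prism_branch s \<beta> \<epsilon>) = (\<lambda>_. 0)" "lc_vector (prism_branch s \<beta> \<epsilon>) = (\<lambda>_. 1)"
    by (simp_all add: val_vector_def lc_vector_def)
qed

text \<open>
  The coefficient of \<open>t\<^bsup>\<beta>/2\<^esup>\<close> of the coordinate \<open>k\<close> is \<open>\<epsilon> k * s k\<close>, which determines the sign
  \<open>\<epsilon> k\<close> because \<open>s k\<close> is nonzero.
\<close>

lemma card_prism_branches:
  fixes s :: "'l::nontriv mod_ring \<Rightarrow> complex"
  assumes "\<And>k. s k \<noteq> 0"
  shows "card {prism_branch s \<beta> \<epsilon> | \<epsilon>. \<forall>k. \<epsilon> k \<in> {1, -1}} = 2 ^ CARD('l)"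
proof -
  let ?E = "PiE UNIV (\<lambda>_. {1, -1}) :: ('l mod_ring \<Rightarrow> complex) set"
  have "{prism_branch s \<beta> \<epsilon> | \<epsilon>. \<forall>k. \<epsilon> k \<in> {1, -1}} = prism_branch s \<beta> ` ?E"
    by (auto simp: PiE_UNIV_domain)
  moreover have "inj_on (prism_branch s \<beta>) ?E"
  proof (rule inj_onI, rule ext)
    fix \<epsilon> \<delta> k assume "prism_branch s \<beta> \<epsilon> = prism_branch s \<beta> \<delta>"
    hence "puiseux_nth (prism_branch s \<beta> \<epsilon> (k, Side_A)) (\<beta> / 2)
        = puiseux_nth (prism_branch s \<beta> \<delta> (k, Side_A)) (\<beta> / 2)" by simp
    thus "\<epsilon> k = \<delta> k"
      using assms by (simp add: prism_branch_def puiseux_nth_simps puiseux_nth_monom)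
  qed
  moreover have "card ?E = 2 ^ CARD('l)"
    by (simp add: card_PiE numeral_2_eq_2)
  ultimately show ?thesis by (simp add: card_image)
qed

section \<open>The initial forms and their common zero\<close>

definition cross_gens :: "('i \<times> side, 'k::comm_ring_1) laurent set" where
  "cross_gens = range (\<lambda>k. (laurent_var (k, Side_A) - 1) * (laurent_var (k, Side_D) - 1))
     \<union> range (\<lambda>k. laurent_var (k, Side_A) - laurent_var (k, Side_D))"

lemma init_form_prism_system:
  fixes lam :: "'l::nontriv mod_ring \<Rightarrow> complex"
  assumes "\<beta> > 0"
  shows "init_form ` prism_system lam \<beta> = cross_gens"
proof -
  have r: "range (\<lambda>k::'l mod_ring. f (k + 1)) = range f" for f :: "'l mod_ring \<Rightarrow> ('l prism_var, complex) laurent"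
    using image_image[of f "\<lambda>k. k + 1" UNIV] surj_plus_one[where ?'a = "'l mod_ring"] by simp
  have "init_form (prism_gA lam \<beta> k) = (laurent_var (k + 1, Side_A) - 1) * (laurent_var (k + 1, Side_D) - 1)"
    "init_form (prism_gD k) = laurent_var (k + 1, Side_A) - laurent_var (k + 1, Side_D)" for k
    using assms by (simp_all add: prism_gA_def prism_gD_def init_form_cross init_form_var_diff)
  hence "init_form ` prism_system lam \<beta> = range (\<lambda>k. (laurent_var (k + 1, Side_A) - 1) * (laurent_var (k + 1, Side_D) - 1))
     \<union> range (\<lambda>k. laurent_var (k + 1, Side_A) - laurent_var (k + 1, Side_D))"
    by (simp add: prism_system_def image_Un image_image)
  thus ?thesis unfolding cross_gens_def
    by (simp only: r[of "\<lambda>k. (laurent_var (k, Side_A) - 1) * (laurent_var (k, Side_D) - 1)"]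
        r[of "\<lambda>k. laurent_var (k, Side_A) - laurent_var (k, Side_D)"])
qed

lemma torus_zeros_cross_gens:
  "torus_zeros (cross_gens :: ('i::finite \<times> side, 'k::field) laurent set) = {\<lambda>_. 1}"
proof (intro equalityI subsetI)
  fix x :: "'i \<times> side \<Rightarrow> 'k" assume x: "x \<in> torus_zeros cross_gens"
  hence nz: "\<And>i. x i \<noteq> 0" by (auto simp: torus_zeros_def)
  from x have "laurent_eval ((laurent_var (k, Side_A) - 1) * (laurent_var (k, Side_D) - 1)) x = 0"
    "laurent_eval (laurent_var (k, Side_A) - laurent_var (k, Side_D)) x = 0" for k
    by (auto simp: torus_zeros_def cross_gens_def)
  hence "x (k, Side_A) = 1 \<and> x (k, Side_D) = 1" for k
    by (simp add: laurent_eval_simps laurent_eval_var laurent_eval_mult[OF nz])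
  hence "x (k, b) = 1" for k b
    by (cases b) auto
  hence "x = (\<lambda>_. 1)" by auto
  thus "x \<in> {\<lambda>_. 1}" by simp
qed (auto simp: torus_zeros_def cross_gens_def laurent_eval_simps laurent_eval_var laurent_eval_mult)

section \<open>Localization and length\<close>

lemma (in monoid) Units_l_cancel_inv:
  "s \<in> Units G \<Longrightarrow> y \<in> carrier G \<Longrightarrow> s \<otimes> (inv s \<otimes> y) = y"
  using m_assoc[of s "inv s" y] by (simp add: Units_closed)

lemma (in comm_monoid) Units_conjugate:
  "s \<in> Units G \<Longrightarrow> y \<in> carrier G \<Longrightarrow> s \<otimes> (y \<otimes> inv s) = y"
  using Units_l_cancel_inv[of s y] by (simp add: m_comm)

lemma loc_rel_units:
  assumes R: "cring R" and units: "carrier R - P \<subseteq> Units R" and P: "primeideal P R"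
  shows "((a, s), (b, u)) \<in> loc_rel R P \<longleftrightarrow>
     a \<in> carrier R \<and> b \<in> carrier R \<and> s \<in> carrier R - P \<and> u \<in> carrier R - P \<and>
     a \<otimes>\<^bsub>R\<^esub> inv\<^bsub>R\<^esub> s = b \<otimes>\<^bsub>R\<^esub> inv\<^bsub>R\<^esub> u"
proof -
  interpret R: cring R by (rule R)
  interpret P: primeideal P R by (rule P)
  have one: "\<one>\<^bsub>R\<^esub> \<in> carrier R - P"
    using P.I_notcarr P.one_imp_carrier by auto
  have iff: "(\<exists>w\<in>carrier R - P. w \<otimes>\<^bsub>R\<^esub> (a \<otimes>\<^bsub>R\<^esub> u) = w \<otimes>\<^bsub>R\<^esub> (b \<otimes>\<^bsub>R\<^esub> s))
      \<longleftrightarrow> a \<otimes>\<^bsub>R\<^esub> inv\<^bsub>R\<^esub> s = b \<otimes>\<^bsub>R\<^esub> inv\<^bsub>R\<^esub> u"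
    if a: "a \<in> carrier R" and b: "b \<in> carrier R" and s: "s \<in> carrier R - P" and u: "u \<in> carrier R - P"
  proof
    assume "\<exists>w\<in>carrier R - P. w \<otimes>\<^bsub>R\<^esub> (a \<otimes>\<^bsub>R\<^esub> u) = w \<otimes>\<^bsub>R\<^esub> (b \<otimes>\<^bsub>R\<^esub> s)"
    then obtain w where w: "w \<in> carrier R - P" "w \<otimes>\<^bsub>R\<^esub> (a \<otimes>\<^bsub>R\<^esub> u) = w \<otimes>\<^bsub>R\<^esub> (b \<otimes>\<^bsub>R\<^esub> s)" by blast
    note U = subsetD[OF units s] subsetD[OF units u] subsetD[OF units w(1)]
    have eq: "a \<otimes>\<^bsub>R\<^esub> u = b \<otimes>\<^bsub>R\<^esub> s"
      using w U a b s u by (simp add: R.Units_l_cancel)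
    have "a \<otimes>\<^bsub>R\<^esub> inv\<^bsub>R\<^esub> s = (a \<otimes>\<^bsub>R\<^esub> u) \<otimes>\<^bsub>R\<^esub> (inv\<^bsub>R\<^esub> s \<otimes>\<^bsub>R\<^esub> inv\<^bsub>R\<^esub> u)"
      using a u s U by (simp add: R.m_ac R.Units_l_cancel_inv R.Units_conjugate)
    also have "\<dots> = b \<otimes>\<^bsub>R\<^esub> inv\<^bsub>R\<^esub> u"
      unfolding eq using b u s U by (simp add: R.m_ac R.Units_l_cancel_inv R.Units_conjugate)
    finally show "a \<otimes>\<^bsub>R\<^esub> inv\<^bsub>R\<^esub> s = b \<otimes>\<^bsub>R\<^esub> inv\<^bsub>R\<^esub> u" .
  next
    assume eq: "a \<otimes>\<^bsub>R\<^esub> inv\<^bsub>R\<^esub> s = b \<otimes>\<^bsub>R\<^esub> inv\<^bsub>R\<^esub> u"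
    note U = subsetD[OF units s] subsetD[OF units u]
    have "a \<otimes>\<^bsub>R\<^esub> u = (a \<otimes>\<^bsub>R\<^esub> inv\<^bsub>R\<^esub> s) \<otimes>\<^bsub>R\<^esub> (s \<otimes>\<^bsub>R\<^esub> u)"
      using a u s U by (simp add: R.m_ac R.Units_l_cancel_inv R.Units_conjugate)
    also have "\<dots> = b \<otimes>\<^bsub>R\<^esub> s"
      unfolding eq using b u s U by (simp add: R.m_ac R.Units_l_cancel_inv R.Units_conjugate)
    finally show "\<exists>w\<in>carrier R - P. w \<otimes>\<^bsub>R\<^esub> (a \<otimes>\<^bsub>R\<^esub> u) = w \<otimes>\<^bsub>R\<^esub> (b \<otimes>\<^bsub>R\<^esub> s)"
      using one by (intro bexI[of _ "\<one>\<^bsub>R\<^esub>"]) auto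
  qed
  show ?thesis unfolding loc_rel_def using iff by auto
qed

text \<open>
  The ring operations on fractions are unions over all representatives; by well-definedness all
  members of such a union agree.
\<close>

lemma UN_pairs_const:
  assumes "(a0, s0) \<in> p" "(b0, u0) \<in> q"
    and "\<And>a s b u. (a, s) \<in> p \<Longrightarrow> (b, u) \<in> q \<Longrightarrow> g a s b u = c"
  shows "(\<Union>(a, s)\<in>p. \<Union>(b, u)\<in>q. g a s b u) = c"
  using assms by fastforce

text \<open>
  If everything outside \<open>P\<close> is already invertible, then each class \<open>a / s\<close> contains exactly one
  fraction with denominator \<open>1\<close>, namely \<open>a s\<^sup>-\<^sup>1 / 1\<close>.
\<close>

lemma localization_at_units_iso:
  assumes R: "cring R" and units: "carrier R - P \<subseteq> Units R" and P: "primeideal P R"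
  shows "(\<lambda>a. loc_frac R P a \<one>\<^bsub>R\<^esub>) \<in> ring_iso R (localization R P)"
proof -
  interpret R: cring R by (rule R)
  interpret P: primeideal P R by (rule P)
  define \<iota> where "\<iota> a = loc_frac R P a \<one>\<^bsub>R\<^esub>" for a
  \<comment> \<open>the value of the fraction \<open>a / s\<close>, computed inside \<open>R\<close>\<close>
  define q where "q a s = a \<otimes>\<^bsub>R\<^esub> inv\<^bsub>R\<^esub> s" for a s
  note rel = loc_rel_units[OF assms]
  have one: "\<one>\<^bsub>R\<^esub> \<in> carrier R - P"
    using P.I_notcarr P.one_imp_carrier by auto
  have s_mult: "s \<otimes>\<^bsub>R\<^esub> u \<in> carrier R - P" if "s \<in> carrier R - P" "u \<in> carrier R - P" for s u
    using that P.I_prime by auto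
  have U: "s \<in> Units R" if "s \<in> carrier R - P" for s
    using that units by auto
  have q_closed: "q a s \<in> carrier R" if "a \<in> carrier R" "s \<in> carrier R - P" for a s
    using that U[of s] by (simp add: q_def)
  have q_one: "q a \<one>\<^bsub>R\<^esub> = a" if "a \<in> carrier R" for a
    using that by (simp add: q_def)
  have q_mult: "q (a \<otimes>\<^bsub>R\<^esub> b) (s \<otimes>\<^bsub>R\<^esub> u) = q a s \<otimes>\<^bsub>R\<^esub> q b u"
    and q_add: "q (a \<otimes>\<^bsub>R\<^esub> u \<oplus>\<^bsub>R\<^esub> b \<otimes>\<^bsub>R\<^esub> s) (s \<otimes>\<^bsub>R\<^esub> u) = q a s \<oplus>\<^bsub>R\<^esub> q b u"
    if "a \<in> carrier R" "b \<in> carrier R" "s \<in> carrier R - P" "u \<in> carrier R - P" for a b s u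
  proof -
    note U' = U[OF that(3)] U[OF that(4)]
    have inv: "inv\<^bsub>R\<^esub> (s \<otimes>\<^bsub>R\<^esub> u) = inv\<^bsub>R\<^esub> s \<otimes>\<^bsub>R\<^esub> inv\<^bsub>R\<^esub> u"
      using U' that by (intro R.comm_inv_char) (simp_all add: R.m_ac R.Units_l_cancel_inv R.Units_conjugate)
    show "q (a \<otimes>\<^bsub>R\<^esub> b) (s \<otimes>\<^bsub>R\<^esub> u) = q a s \<otimes>\<^bsub>R\<^esub> q b u"
      using U' that by (simp add: q_def inv R.m_ac)
    have "a \<otimes>\<^bsub>R\<^esub> u \<otimes>\<^bsub>R\<^esub> (inv\<^bsub>R\<^esub> s \<otimes>\<^bsub>R\<^esub> inv\<^bsub>R\<^esub> u) = a \<otimes>\<^bsub>R\<^esub> inv\<^bsub>R\<^esub> s"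
      "b \<otimes>\<^bsub>R\<^esub> s \<otimes>\<^bsub>R\<^esub> (inv\<^bsub>R\<^esub> s \<otimes>\<^bsub>R\<^esub> inv\<^bsub>R\<^esub> u) = b \<otimes>\<^bsub>R\<^esub> inv\<^bsub>R\<^esub> u"
      using U' that by (simp_all add: R.m_ac R.Units_l_cancel_inv R.Units_conjugate)
    thus "q (a \<otimes>\<^bsub>R\<^esub> u \<oplus>\<^bsub>R\<^esub> b \<otimes>\<^bsub>R\<^esub> s) (s \<otimes>\<^bsub>R\<^esub> u) = q a s \<oplus>\<^bsub>R\<^esub> q b u"
      using U' that by (simp add: q_def inv R.l_distr)
  qed
  have frac: "loc_frac R P a s = \<iota> (q a s)" if "a \<in> carrier R" "s \<in> carrier R - P" for a s
    using that q_closed[OF that] one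
    by (auto simp: loc_frac_def \<iota>_def rel q_def)
  have mem_\<iota>: "(b, u) \<in> \<iota> a \<longleftrightarrow> b \<in> carrier R \<and> u \<in> carrier R - P \<and> q b u = a" if "a \<in> carrier R" for a b u
    using that one by (auto simp: \<iota>_def loc_frac_def rel q_def)
  have ne: "(a, \<one>\<^bsub>R\<^esub>) \<in> \<iota> a" if "a \<in> carrier R" for a
    using that one by (simp add: mem_\<iota> q_one)
  have "\<iota> \<in> ring_iso R (localization R P)"
  proof (rule ring_iso_memI)
    have "carrier (localization R P) = \<iota> ` carrier R"
    proof (intro equalityI subsetI)
      fix x assume "x \<in> carrier (localization R P)"
      then obtain a s where "a \<in> carrier R" "s \<in> carrier R - P" "x = loc_frac R P a s"
        by (auto simp: localization_def quotient_def loc_frac_def)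
      thus "x \<in> \<iota> ` carrier R" using frac q_closed by auto
    next
      fix x assume "x \<in> \<iota> ` carrier R"
      thus "x \<in> carrier (localization R P)"
        using one by (auto simp: localization_def quotient_def loc_frac_def \<iota>_def)
    qed
    moreover have "inj_on \<iota> (carrier R)"
      using ne mem_\<iota> q_one by (metis inj_onI)
    ultimately show "bij_betw \<iota> (carrier R) (carrier (localization R P))"
      by (simp add: bij_betw_def)
    thus "\<iota> a \<in> carrier (localization R P)" if "a \<in> carrier R" for a
      using that by (auto simp: bij_betw_def)
    show "\<iota> (a \<otimes>\<^bsub>R\<^esub> b) = \<iota> a \<otimes>\<^bsub>localization R P\<^esub> \<iota> b"
      and "\<iota> (a \<oplus>\<^bsub>R\<^esub> b) = \<iota> a \<oplus>\<^bsub>localization R P\<^esub> \<iota> b"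
      if ab: "a \<in> carrier R" "b \<in> carrier R" for a b
    proof -
      have "loc_frac R P (a' \<otimes>\<^bsub>R\<^esub> b') (s \<otimes>\<^bsub>R\<^esub> u) = \<iota> (a \<otimes>\<^bsub>R\<^esub> b)"
        "loc_frac R P (a' \<otimes>\<^bsub>R\<^esub> u \<oplus>\<^bsub>R\<^esub> b' \<otimes>\<^bsub>R\<^esub> s) (s \<otimes>\<^bsub>R\<^esub> u) = \<iota> (a \<oplus>\<^bsub>R\<^esub> b)"
        if "(a', s) \<in> \<iota> a" "(b', u) \<in> \<iota> b" for a' b' s u
        using that s_mult[of s u] by (auto simp: mem_\<iota> ab frac q_mult q_add)
      thus "\<iota> (a \<otimes>\<^bsub>R\<^esub> b) = \<iota> a \<otimes>\<^bsub>localization R P\<^esub> \<iota> b"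
        "\<iota> (a \<oplus>\<^bsub>R\<^esub> b) = \<iota> a \<oplus>\<^bsub>localization R P\<^esub> \<iota> b"
        unfolding localization_def ring_record_simps
        by (simp_all only: UN_pairs_const[OF ne[OF ab(1)] ne[OF ab(2)]])
    qed
    show "\<iota> \<one>\<^bsub>R\<^esub> = \<one>\<^bsub>localization R P\<^esub>"
      by (simp add: \<iota>_def localization_def)
  qed
  thus ?thesis unfolding \<iota>_def .
qed

text \<open>
  That the localization is a ring is transported along the bijection above, so that the ring
  axioms need no verification on fractions.
\<close>

lemma localization_at_units_hom:
  assumes R: "cring R" and units: "carrier R - P \<subseteq> Units R" and P: "primeideal P R"
  shows "ring_hom_ring R (localization R P) (\<lambda>a. loc_frac R P a \<one>\<^bsub>R\<^esub>)"
proof -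
  interpret R: cring R by (rule R)
  note iso = localization_at_units_iso[OF assms]
  have "ring ((localization R P)\<lparr>zero := loc_frac R P \<zero>\<^bsub>R\<^esub> \<one>\<^bsub>R\<^esub>\<rparr>)"
    by (rule R.ring_iso_imp_img_ring[OF iso])
  hence "ring (localization R P)" by (simp add: localization_def)
  with iso R.ring_axioms show ?thesis
    by (auto simp: ring_iso_def intro: ring_hom_ringI2)
qed

lemma ideal_image_surj:
  assumes "ring_hom_ring R S h" and surj: "h ` carrier R = carrier S" and "ideal J R"
  shows "ideal (h ` J) S"
proof -
  interpret h: ring_hom_ring R S h by fact
  interpret J: ideal J R by fact
  show ?thesis
  proof (rule idealI)
    show "ring S" by (rule h.S.ring_axioms)
    show "subgroup (h ` J) (add_monoid S)"
      by (rule h.img_is_add_subgroup) (rule J.a_subgroup)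
  next
    fix a x assume "a \<in> h ` J" "x \<in> carrier S"
    then obtain j r where jr: "j \<in> J" "r \<in> carrier R" "a = h j" "x = h r"
      using surj by (metis imageE)
    hence "x \<otimes>\<^bsub>S\<^esub> a = h (r \<otimes>\<^bsub>R\<^esub> j)" "a \<otimes>\<^bsub>S\<^esub> x = h (j \<otimes>\<^bsub>R\<^esub> r)"
      by (auto simp: J.Icarr)
    thus "x \<otimes>\<^bsub>S\<^esub> a \<in> h ` J" "a \<otimes>\<^bsub>S\<^esub> x \<in> h ` J"
      using J.I_l_closed[OF jr(1,2)] J.I_r_closed[OF jr(1,2)] by simp_all
  qed
qed

lemma ideal_vimage_image_surj:
  assumes "ring_hom_ring R S h" and "ideal J R" "a_kernel R S h \<subseteq> J"
  shows "{r \<in> carrier R. h r \<in> h ` J} = J"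
proof -
  interpret h: ring_hom_ring R S h by fact
  interpret J: ideal J R by fact
  have "r \<in> J" if r: "r \<in> carrier R" and j: "j \<in> J" "h r = h j" for r j
  proof -
    have jc: "j \<in> carrier R" using j by (simp add: J.Icarr)
    have "h (r \<ominus>\<^bsub>R\<^esub> j) = \<zero>\<^bsub>S\<^esub>"
      using r jc j by (simp add: a_minus_def h.S.r_neg)
    hence "r \<ominus>\<^bsub>R\<^esub> j \<in> a_kernel R S h"
      unfolding a_kernel_def' using r jc by (intro CollectI conjI h.R.minus_closed)
    hence "r \<ominus>\<^bsub>R\<^esub> j \<in> J" using assms(3) by blast
    hence "(r \<ominus>\<^bsub>R\<^esub> j) \<oplus>\<^bsub>R\<^esub> j \<in> J" using j(1) by (rule J.a_closed)
    thus "r \<in> J" using r jc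
      by (simp only: a_minus_def h.R.a_assoc h.R.a_inv_closed h.R.l_neg h.R.r_zero)
  qed
  thus ?thesis using J.Icarr by blast
qed

text \<open>
  Only ideals above a fixed \<open>I\<close> are admitted: by the correspondence theorem these are the chains
  that compute the length of the quotient by \<open>I\<close>.
\<close>

definition is_ideal_chain :: "('a, 'm) ring_scheme \<Rightarrow> 'a set \<Rightarrow> nat \<Rightarrow> (nat \<Rightarrow> 'a set) \<Rightarrow> bool" where
  "is_ideal_chain R I n J \<longleftrightarrow> (\<forall>i\<le>n. ideal (J i) R \<and> I \<subseteq> J i) \<and> (\<forall>i<n. J i \<subset> J (Suc i))"

text \<open>
  Image and preimage are inverse, strictly monotone bijections between the ideals of \<open>S\<close> and the
  ideals of \<open>R\<close> above the kernel.
\<close>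

lemma ring_length_surj:
  assumes hom: "ring_hom_ring R S h" and surj: "h ` carrier R = carrier S"
  shows "ring_length S = (SUP n \<in> {n. \<exists>J. is_ideal_chain R (a_kernel R S h) n J}. enat n)"
proof -
  interpret h: ring_hom_ring R S h by fact
  have "(\<exists>J. (\<forall>i\<le>n. ideal (J i) S) \<and> (\<forall>i<n. J i \<subset> J (Suc i)))
      \<longleftrightarrow> (\<exists>J. is_ideal_chain R (a_kernel R S h) n J)" for n
  proof
    assume "\<exists>J. (\<forall>i\<le>n. ideal (J i) S) \<and> (\<forall>i<n. J i \<subset> J (Suc i))"
    then obtain J where J: "\<And>i. i \<le> n \<Longrightarrow> ideal (J i) S" "\<And>i. i < n \<Longrightarrow> J i \<subset> J (Suc i)" by blast
    define V where "V i = {r \<in> carrier R. h r \<in> J i}" for i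
    have img: "h ` V i = J i" if "i \<le> n" for i
    proof -
      have "J i \<subseteq> h ` carrier R"
        using additive_subgroup.a_subset[OF ideal.axioms(1)[OF J(1)[OF that]]] surj by simp
      thus ?thesis by (auto simp: V_def)
    qed
    have "is_ideal_chain R (a_kernel R S h) n V"
      unfolding is_ideal_chain_def
    proof (intro conjI allI impI)
      fix i assume i: "i \<le> n"
      show "ideal (V i) R" unfolding V_def by (rule h.ideal_vimage) (rule J(1)[OF i])
      show "a_kernel R S h \<subseteq> V i"
        unfolding V_def a_kernel_def'
        using additive_subgroup.zero_closed[OF ideal.axioms(1)[OF J(1)[OF i]]] by force
    next
      fix i assume i: "i < n"
      have "V i \<subseteq> V (Suc i)" using J(2)[OF i] by (auto simp: V_def)
      moreover have "h ` V i \<noteq> h ` V (Suc i)" using J(2)[OF i] i img by auto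
      ultimately show "V i \<subset> V (Suc i)" by auto
    qed
    thus "\<exists>J. is_ideal_chain R (a_kernel R S h) n J" by blast
  next
    assume "\<exists>J. is_ideal_chain R (a_kernel R S h) n J"
    then obtain J where J: "\<And>i. i \<le> n \<Longrightarrow> ideal (J i) R" "\<And>i. i \<le> n \<Longrightarrow> a_kernel R S h \<subseteq> J i"
      "\<And>i. i < n \<Longrightarrow> J i \<subset> J (Suc i)" unfolding is_ideal_chain_def by blast
    have "h ` J i \<subset> h ` J (Suc i)" if "i < n" for i
    proof
      show "h ` J i \<subseteq> h ` J (Suc i)" using J(3)[OF that] by blast
      show "h ` J i \<noteq> h ` J (Suc i)"
        using J(3)[OF that] that ideal_vimage_image_surj[OF hom J(1,2)]
        by (metis Suc_leI less_imp_le less_irrefl)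
    qed
    with J(1) show "\<exists>J. (\<forall>i\<le>n. ideal (J i) S) \<and> (\<forall>i<n. J i \<subset> J (Suc i))"
      by (intro exI[of _ "\<lambda>i. h ` J i"]) (auto intro: ideal_image_surj[OF hom surj])
  qed
  thus ?thesis unfolding ring_length_def by simp
qed

text \<open>
  Together with \<open>unit_mod_cross_ideal\<close> this removes the localization from the definition of the
  length at a point.
\<close>

lemma ring_length_localization_at_units:
  assumes R: "cring R" and units: "carrier R - P \<subseteq> Units R" and P: "primeideal P R"
  shows "ring_length (localization R P) = ring_length R"
proof -
  interpret R: cring R by (rule R)
  define \<iota> where "\<iota> = (\<lambda>a. loc_frac R P a \<one>\<^bsub>R\<^esub>)"
  have hom: "ring_hom_ring R (localization R P) \<iota>"
    unfolding \<iota>_def by (rule localization_at_units_hom[OF assms])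
  have bij: "bij_betw \<iota> (carrier R) (carrier (localization R P))"
    using localization_at_units_iso[OF assms] by (simp add: ring_iso_def \<iota>_def)
  have zero: "\<iota> \<zero>\<^bsub>R\<^esub> = \<zero>\<^bsub>localization R P\<^esub>"
    by (simp add: \<iota>_def localization_def)
  have ker: "a_kernel R (localization R P) \<iota> = {\<zero>\<^bsub>R\<^esub>}"
    unfolding a_kernel_def' zero[symmetric]
    using bij R.zero_closed by (blast dest: bij_betw_imp_inj_on inj_onD)
  have "{\<zero>\<^bsub>R\<^esub>} \<subseteq> J" if "ideal J R" for J
    using additive_subgroup.zero_closed[OF ideal.axioms(1)[OF that]] by simp
  hence chain: "is_ideal_chain R {\<zero>\<^bsub>R\<^esub>} n J \<longleftrightarrow>
      (\<forall>i\<le>n. ideal (J i) R) \<and> (\<forall>i<n. J i \<subset> J (Suc i))" for n J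
    unfolding is_ideal_chain_def by blast
  show ?thesis
    unfolding ring_length_surj[OF hom bij_betw_imp_surj_on[OF bij]] ker chain
    by (rule ring_length_def[symmetric])
qed

lemma a_kernel_quotient:
  assumes "ideal I R"
  shows "a_kernel R (R Quot I) ((+>\<^bsub>R\<^esub>) I) = I"
proof -
  interpret I: ideal I R by fact
  have "I +>\<^bsub>R\<^esub> a = I \<longleftrightarrow> a \<in> I" if "a \<in> carrier R" for a
    using that I.a_rcos_const I.rcos_const_imp_mem by blast
  moreover have "\<zero>\<^bsub>R Quot I\<^esub> = I" by (simp add: FactRing_def)
  ultimately show ?thesis unfolding a_kernel_def' using I.Icarr by blast
qed

section \<open>Ideals of a commutative ring type\<close>

lemma ring_of_type_algebra_simps [simp]:
  "carrier ring_of_type_algebra = UNIV"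
  "x \<otimes>\<^bsub>ring_of_type_algebra\<^esub> y = x * y"
  "x \<oplus>\<^bsub>ring_of_type_algebra\<^esub> y = x + y"
  "\<one>\<^bsub>ring_of_type_algebra\<^esub> = 1"
  "\<zero>\<^bsub>ring_of_type_algebra\<^esub> = 0"
  by (simp_all add: ring_of_type_algebra_def)

lemma ring_of_type_algebra_uminus:
  fixes x :: "'a::comm_ring_1"
  shows "\<ominus>\<^bsub>ring_of_type_algebra\<^esub> x = - x"
proof -
  interpret R: cring "ring_of_type_algebra :: 'a ring" by (rule cring_from_type_algebra)
  show ?thesis by (rule R.minus_equality) simp_all
qed

text \<open>
  This form of the ideal axioms lets the computations below run in the type class, where the
  simplifier knows the ring operations.
\<close>

lemma ideal_type_iff:
  fixes J :: "'a::comm_ring_1 set"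
  shows "ideal J ring_of_type_algebra \<longleftrightarrow>
    0 \<in> J \<and> (\<forall>a\<in>J. \<forall>b\<in>J. a + b \<in> J) \<and> (\<forall>a\<in>J. \<forall>r. r * a \<in> J)"
proof
  assume "ideal J (ring_of_type_algebra :: 'a ring)"
  then interpret J: ideal J "ring_of_type_algebra :: 'a ring" .
  show "0 \<in> J \<and> (\<forall>a\<in>J. \<forall>b\<in>J. a + b \<in> J) \<and> (\<forall>a\<in>J. \<forall>r. r * a \<in> J)"
  proof (intro conjI ballI allI)
    show "0 \<in> J" using additive_subgroup.zero_closed[OF J.additive_subgroup_axioms]
      by (simp only: ring_of_type_algebra_simps)
    show "a + b \<in> J" if "a \<in> J" "b \<in> J" for a b
      using additive_subgroup.a_closed[OF J.additive_subgroup_axioms that] by (simp only: ring_of_type_algebra_simps)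
    show "r * a \<in> J" if "a \<in> J" for a r
      using J.I_l_closed[OF that, of r] by (simp only: ring_of_type_algebra_simps UNIV_I)
  qed
next
  assume "0 \<in> J \<and> (\<forall>a\<in>J. \<forall>b\<in>J. a + b \<in> J) \<and> (\<forall>a\<in>J. \<forall>r. r * a \<in> J)"
  hence J: "0 \<in> J" "\<And>a b. a \<in> J \<Longrightarrow> b \<in> J \<Longrightarrow> a + b \<in> J" "\<And>a r. a \<in> J \<Longrightarrow> r * a \<in> J"
    by blast+
  have J': "a * r \<in> J" if "a \<in> J" for a r
    using J(3)[OF that, of r] by (simp add: mult.commute)
  show "ideal J (ring_of_type_algebra :: 'a ring)"
  proof (rule idealI)
    show "ring (ring_of_type_algebra :: 'a ring)" by (rule ring_from_type_algebra)
    show "subgroup J (add_monoid (ring_of_type_algebra :: 'a ring))"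
    proof (rule subgroup.intro)
      fix x assume "x \<in> J"
      hence "(- 1) * x \<in> J" by (rule J(3))
      thus "inv\<^bsub>add_monoid (ring_of_type_algebra :: 'a ring)\<^esub> x \<in> J"
        using ring_of_type_algebra_uminus[of x] by (simp add: a_inv_def)
    qed (simp_all add: J(1,2))
  qed (simp_all add: J(3) J')
qed

lemma ideal_typeD:
  fixes J :: "'a::comm_ring_1 set"
  assumes "ideal J ring_of_type_algebra"
  shows "0 \<in> J" "a \<in> J \<Longrightarrow> b \<in> J \<Longrightarrow> a + b \<in> J" "a \<in> J \<Longrightarrow> r * a \<in> J"
    "a \<in> J \<Longrightarrow> b \<in> J \<Longrightarrow> a - b \<in> J"
proof -
  show 1: "0 \<in> J" "a \<in> J \<Longrightarrow> b \<in> J \<Longrightarrow> a + b \<in> J" "a \<in> J \<Longrightarrow> r * a \<in> J" for a b r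
    using assms unfolding ideal_type_iff by blast+
  show "a - b \<in> J" if "a \<in> J" "b \<in> J"
    using 1(2)[OF that(1) 1(3)[OF that(2), of "- 1"]] by simp
qed

lemma prod_cong_mod_ideal:
  fixes J :: "'a::comm_ring_1 set"
  assumes J: "ideal J ring_of_type_algebra" and "\<And>k. k \<in> A \<Longrightarrow> f k - g k \<in> J"
  shows "prod f A - prod g A \<in> J"
  using assms(2)
proof (induction A rule: infinite_finite_induct)
  case (insert k A)
  have "f k * prod f A - g k * prod g A = f k * (prod f A - prod g A) + prod g A * (f k - g k)"
    by (simp add: algebra_simps)
  thus ?case using insert ideal_typeD[OF J] by simp
qed (simp_all add: ideal_typeD[OF J])

lemma sum_mem_ideal:
  fixes J :: "'a::comm_ring_1 set"
  assumes "ideal J ring_of_type_algebra" and "\<And>k. k \<in> A \<Longrightarrow> f k \<in> J"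
  shows "sum f A \<in> J"
  using assms(2)
  by (induction A rule: infinite_finite_induct) (simp_all add: ideal_typeD[OF assms(1)])

section \<open>Jets at the base point\<close>

text \<open>
  Modulo \<open>x\<^sub>k\<^sub>,\<^sub>A - x\<^sub>k\<^sub>,\<^sub>D\<close> only the total exponent of the two variables of index \<open>k\<close> is visible.
\<close>

definition block_degree :: "('i \<times> side \<Rightarrow>\<^sub>0 int) \<Rightarrow> 'i \<Rightarrow> int" where
  "block_degree \<alpha> k = Poly_Mapping.lookup \<alpha> (k, Side_A) + Poly_Mapping.lookup \<alpha> (k, Side_D)"

text \<open>
  This is the iterated logarithmic derivative in the variables indexed by \<open>S\<close>, taken at the point
  \<open>(1, \<dots>, 1)\<close> after the identification \<open>x\<^sub>k\<^sub>,\<^sub>A = x\<^sub>k\<^sub>,\<^sub>D\<close>. It will turn out to be the coordinate of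
  \<open>f\<close> at the squarefree monomial \<open>\<Prod>k\<in>S. y\<^sub>k\<close> in the algebra \<open>k[y]/(y\<^sub>k\<^sup>2)\<close>, with \<open>y\<^sub>k = x\<^sub>k\<^sub>,\<^sub>A - 1\<close>.
\<close>

definition jet :: "'i set \<Rightarrow> ('i \<times> side, 'k::comm_ring_1) laurent \<Rightarrow> 'k" where
  "jet S = weighted_sum (\<lambda>\<alpha>. \<Prod>k\<in>S. of_int (block_degree \<alpha> k))"

definition tangent :: "'i \<Rightarrow> ('i \<times> side, 'k::comm_ring_1) laurent" where
  "tangent k = laurent_var (k, Side_A) - 1"

lemma block_degree_add: "block_degree (\<alpha> + \<beta>) k = block_degree \<alpha> k + block_degree \<beta> k"
  and block_degree_minus: "block_degree (\<alpha> - \<beta>) k = block_degree \<alpha> k - block_degree \<beta> k"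
  and block_degree_zero: "block_degree 0 k = 0"
  and block_degree_exponent: "block_degree (exponent (j, b)) k = (if j = k then 1 else 0)"
  by (cases b; simp add: block_degree_def lookup_add lookup_minus lookup_single when_def)+

lemma jet_add: "jet S (f + g) = jet S f + jet S g"
  and jet_minus: "jet S (f - g) = jet S f - jet S g"
  and jet_zero: "jet S 0 = 0"
  by (simp_all add: jet_def weighted_sum_add weighted_sum_minus weighted_sum_zero)

text \<open>
  The Leibniz rule: the weight of \<open>\<alpha> + \<beta>\<close> is a product of sums, which expands over the subsets
  of \<open>S\<close>. It is also the multiplication rule of \<open>k[y]/(y\<^sub>k\<^sup>2)\<close> in the basis of squarefree monomials.
\<close>

lemma jet_mult:
  fixes f g :: "('i::finite \<times> side, 'k::comm_ring_1) laurent"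
  shows "jet S (f * g) = (\<Sum>T\<in>Pow S. jet T f * jet (S - T) g)"
  unfolding jet_def
  by (rule weighted_sum_mult[where v = "\<lambda>T \<alpha>. \<Prod>k\<in>S - T. of_int (block_degree \<alpha> k)"])
    (simp add: block_degree_add prod_add)

lemma jet_const:
  fixes S :: "'i::finite set"
  shows "jet S (laurent_const c) = (if S = {} then c else 0)"
  by (cases "S = {}")
    (simp_all add: jet_def laurent_const_def weighted_sum_single block_degree_zero power_0_left)

lemma jet_one:
  fixes S :: "'i::finite set"
  shows "jet S 1 = (if S = {} then 1 else 0)"
  using jet_const[of S 1] by (simp add: laurent_const_def)

lemma jet_var_minus_one:
  fixes S :: "'i::finite set"
  shows "jet S (laurent_var (k, b) - 1 :: ('i \<times> side, 'k::comm_ring_1) laurent) = (if S = {k} then 1 else 0)"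
proof -
  have "jet S (laurent_var (k, b) :: ('i \<times> side, 'k) laurent) = (\<Prod>j\<in>S. if k = j then 1 else 0)"
    by (simp add: jet_def laurent_var_def weighted_sum_single block_degree_exponent if_distrib cong: if_cong)
  also have "\<dots> = (if S \<subseteq> {k} then 1 else 0)"
  proof (cases "S \<subseteq> {k}")
    case False
    then obtain j where "j \<in> S" "k \<noteq> j" by blast
    with False show ?thesis by (subst prod_zero) auto
  qed (auto intro!: prod.neutral)
  finally show ?thesis by (auto simp: jet_minus jet_one)
qed

lemma jet_tangent:
  fixes S :: "'i::finite set"
  shows "jet S (tangent k) = (if S = {k} then 1 else 0)"
  unfolding tangent_def by (rule jet_var_minus_one)

text \<open>
  The functionals \<open>jet S\<close> and the squarefree monomials in the \<open>y\<^sub>k\<close> are dual to each other.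
\<close>

lemma jet_prod_tangent:
  fixes S T :: "'i::finite set"
  shows "jet S (\<Prod>k\<in>T. tangent k :: ('i \<times> side, 'k::comm_ring_1) laurent) = (if S = T then 1 else 0)"
proof (induction T arbitrary: S rule: finite_induct[OF finite])
  case 1
  show ?case by (simp add: jet_one)
next
  case (2 k T)
  have "jet S (\<Prod>k\<in>insert k T. tangent k :: ('i \<times> side, 'k) laurent)
      = (\<Sum>U\<in>Pow S. jet U (tangent k) * jet (S - U) (\<Prod>k\<in>T. tangent k))"
    using 2 by (simp add: jet_mult)
  also have "\<dots> = (\<Sum>U\<in>Pow S. if U = {k} then if S - {k} = T then 1 else 0 else 0)"
    by (rule sum.cong) (auto simp: 2 jet_tangent)
  also have "\<dots> = (if S = insert k T then 1 else 0)"
    using 2(2) by auto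
  finally show ?case .
qed

lemma jet_cross_gens:
  fixes f :: "('i::finite \<times> side, 'k::comm_ring_1) laurent"
  assumes "f \<in> cross_gens"
  shows "jet S f = 0"
proof -
  consider k where "f = (laurent_var (k, Side_A) - 1) * (laurent_var (k, Side_D) - 1)"
    | k where "f = laurent_var (k, Side_A) - laurent_var (k, Side_D)"
    using assms by (auto simp: cross_gens_def)
  thus ?thesis
  proof cases
    case 1
    show ?thesis unfolding 1 jet_mult jet_var_minus_one by (rule sum.neutral) auto
  next
    case 2
    have f: "f = (laurent_var (k, Side_A) - 1) - (laurent_var (k, Side_D) - 1)" by (simp add: 2)
    show ?thesis by (simp only: f jet_minus[of S "laurent_var _ - 1"] jet_var_minus_one diff_self)
  qed
qed

text \<open>
  By the Leibniz rule \<open>jet S (r * f)\<close> only involves jets of \<open>f\<close> at subsets of \<open>S\<close>, so a family of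
  jets that is closed under subsets has an ideal as its common kernel.
\<close>

lemma ideal_jets:
  assumes D: "\<And>S T. S \<in> D \<Longrightarrow> T \<subseteq> S \<Longrightarrow> T \<in> D"
  shows "ideal {f :: ('i::finite \<times> side, 'k::comm_ring_1) laurent. \<forall>S\<in>D. jet S f = 0} ring_of_type_algebra"
  unfolding ideal_type_iff
  by (auto simp: jet_zero jet_add jet_mult intro!: sum.neutral) (metis D Diff_subset mult_zero_right)

section \<open>The initial ideal as a common kernel of jets\<close>

text \<open>
  In the following, \<open>J\<close> is any ideal that contains the initial forms. Apart from the initial ideal
  itself, the results are used for prime ideals.
\<close>

context
  fixes J :: "('i::finite \<times> side, 'k::comm_ring_1) laurent set"
  assumes J: "ideal J ring_of_type_algebra" and gens: "cross_gens \<subseteq> J"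
begin

lemma var_diff_mem: "laurent_var (k, Side_A) - laurent_var (k, Side_D) \<in> J"
  using gens by (auto simp: cross_gens_def)

lemma tangent_square_mem: "tangent k * tangent k \<in> J"
proof -
  have "(laurent_var (k, Side_A) - 1) * (laurent_var (k, Side_D) - 1) \<in> J"
    using gens by (auto simp: cross_gens_def)
  with var_diff_mem
  have "(laurent_var (k, Side_A) - 1) * (laurent_var (k, Side_D) - 1)
      + tangent k * (laurent_var (k, Side_A) - laurent_var (k, Side_D)) \<in> J"
    using ideal_typeD[OF J] by blast
  thus ?thesis by (simp add: tangent_def algebra_simps)
qed

text \<open>
  Modulo \<open>J\<close> both variables of index \<open>k\<close> equal \<open>1 + y\<^sub>k\<close>, and \<open>y\<^sub>k\<^sup>2 = 0\<close> gives
  \<open>(1 + y\<^sub>k)\<^sup>n = 1 + n y\<^sub>k\<close> for every integer \<open>n\<close>. Since the exponents may be negative, the proof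
  goes by induction along differences of exponent vectors instead of powers.
\<close>

lemma monomial_cong_mod:
  "Poly_Mapping.single \<alpha> 1 - (\<Prod>k\<in>UNIV. 1 + of_int (block_degree \<alpha> k) * tangent k) \<in> J"
proof -
  let ?E = "\<lambda>\<alpha>. Poly_Mapping.single \<alpha> 1 :: ('i \<times> side, 'k) laurent"
  let ?M = "\<lambda>\<alpha>. \<Prod>k\<in>UNIV. 1 + of_int (block_degree \<alpha> k) * tangent k :: ('i \<times> side, 'k) laurent"
  have "?E \<alpha> - ?M \<alpha> \<in> J"
  proof (induction \<alpha> rule: frag_induction[OF subset_UNIV, case_names zero one diff])
    case zero
    show ?case by (simp add: block_degree_zero ideal_typeD(1)[OF J])
  next
    case (one v)
    obtain k b where v: "v = (k, b)" by (cases v)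
    have "?M (exponent v) = (\<Prod>j\<in>UNIV. if j = k then 1 + tangent j else 1)"
      by (rule prod.cong) (auto simp: v block_degree_exponent)
    also have "\<dots> = laurent_var (k, Side_A)"
      by (simp add: tangent_def)
    finally have "?E (exponent v) - ?M (exponent v) = laurent_var (k, b) - laurent_var (k, Side_A)"
      by (simp add: v laurent_var_def)
    also have "\<dots> \<in> J"
      using ideal_typeD(1)[OF J] ideal_typeD(4)[OF J ideal_typeD(1)[OF J] var_diff_mem[of k]]
      by (cases b) simp_all
    finally show ?case .
  next
    case (diff \<alpha> \<beta>)
    have "?M (\<alpha> - \<beta>) * ?M \<beta> - ?M \<alpha> \<in> J"
      unfolding prod.distrib[symmetric]
    proof (rule prod_cong_mod_ideal[OF J])
      fix k :: 'i
      let ?a = "of_int (block_degree \<alpha> k) :: ('i \<times> side, 'k) laurent"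
      let ?b = "of_int (block_degree \<beta> k) :: ('i \<times> side, 'k) laurent"
      have "(1 + of_int (block_degree (\<alpha> - \<beta>) k) * tangent k) * (1 + ?b * tangent k) - (1 + ?a * tangent k)
          = ((?a - ?b) * ?b) * (tangent k * tangent k)"
        by (simp add: block_degree_minus algebra_simps)
      thus "(1 + of_int (block_degree (\<alpha> - \<beta>) k) * tangent k) * (1 + ?b * tangent k)
          - (1 + ?a * tangent k) \<in> J"
        using ideal_typeD(3)[OF J tangent_square_mem] by simp
    qed
    \<comment> \<open>write \<open>E\<close> for the monomial and \<open>M\<close> for the linearized product: multiplying
      \<open>E \<alpha> - M (\<alpha> - \<beta>) E \<beta>\<close> by the unit \<open>E (- \<beta>)\<close> gives the claim\<close>
    hence "?E (- \<beta>) * ((?E \<alpha> - ?M \<alpha>) - (?M (\<alpha> - \<beta>) * ?M \<beta> - ?M \<alpha>)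
        - ?M (\<alpha> - \<beta>) * (?E \<beta> - ?M \<beta>)) \<in> J"
      by (intro ideal_typeD(3)[OF J] ideal_typeD(4)[OF J ideal_typeD(4)[OF J diff(1)]]
            ideal_typeD(3)[OF J diff(2)])
    also have "?E (- \<beta>) * ((?E \<alpha> - ?M \<alpha>) - (?M (\<alpha> - \<beta>) * ?M \<beta> - ?M \<alpha>) - ?M (\<alpha> - \<beta>) * (?E \<beta> - ?M \<beta>))
        = ?E (- \<beta>) * ?E \<alpha> - (?E (- \<beta>) * ?E \<beta>) * ?M (\<alpha> - \<beta>)"
      by (simp add: algebra_simps)
    also have "\<dots> = ?E (\<alpha> - \<beta>) - ?M (\<alpha> - \<beta>)"
      by (simp add: mult_single)
    finally show ?case .
  qed
  thus ?thesis .
qed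

text \<open>
  Taylor expansion at the point \<open>(1, \<dots>, 1)\<close>: all terms that are not squarefree in the \<open>y\<^sub>k\<close>
  vanish. Consequently the squarefree monomials span the quotient by \<open>J\<close>.
\<close>

lemma taylor_cong_mod:
  "f - (\<Sum>S\<in>UNIV. laurent_const (jet S f) * (\<Prod>k\<in>S. tangent k)) \<in> J"
proof (induction f rule: laurent_induct)
  case (single \<alpha> c)
  have expand: "(\<Prod>k\<in>UNIV. 1 + of_int (block_degree \<alpha> k) * tangent k)
      = (\<Sum>S\<in>UNIV. of_int (\<Prod>k\<in>S. block_degree \<alpha> k) * (\<Prod>k\<in>S. tangent k)
          :: ('i \<times> side, 'k) laurent)"
    by (subst add.commute, subst prod_add) (simp_all add: prod.distrib)
  have const: "laurent_const c * of_int z = (laurent_const (c * of_int z) :: ('i \<times> side, 'k) laurent)" for z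
    by (simp add: laurent_const_def mult_single flip: single_of_int)
  have "laurent_const c * (\<Prod>k\<in>UNIV. 1 + of_int (block_degree \<alpha> k) * tangent k)
      = (\<Sum>S\<in>UNIV. laurent_const (jet S (Poly_Mapping.single \<alpha> c)) * (\<Prod>k\<in>S. tangent k))"
    unfolding expand sum_distrib_left mult.assoc[symmetric] const
    by (simp add: jet_def weighted_sum_single)
  hence "Poly_Mapping.single \<alpha> c
        - (\<Sum>S\<in>UNIV. laurent_const (jet S (Poly_Mapping.single \<alpha> c)) * (\<Prod>k\<in>S. tangent k))
      = laurent_const c * (Poly_Mapping.single \<alpha> 1 - (\<Prod>k\<in>UNIV. 1 + of_int (block_degree \<alpha> k) * tangent k))"
    by (simp add: right_diff_distrib) (simp add: laurent_const_def mult_single)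
  thus ?case using ideal_typeD(3)[OF J monomial_cong_mod] by simp
next
  case (add f g)
  have "laurent_const (a + b) = (laurent_const a + laurent_const b :: ('i \<times> side, 'k) laurent)" for a b :: 'k
    by (simp add: laurent_const_def single_add)
  hence "f + g - (\<Sum>S\<in>UNIV. laurent_const (jet S (f + g)) * (\<Prod>k\<in>S. tangent k))
      = (f - (\<Sum>S\<in>UNIV. laurent_const (jet S f) * (\<Prod>k\<in>S. tangent k)))
      + (g - (\<Sum>S\<in>UNIV. laurent_const (jet S g) * (\<Prod>k\<in>S. tangent k)))"
    by (simp only: jet_add distrib_right sum.distrib add_diff_add)
  also have "\<dots> \<in> J" by (rule ideal_typeD(2)[OF J add])
  finally show ?case .
qed

lemma jets_zero_mem:
  assumes "\<And>S. jet S f = 0"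
  shows "f \<in> J"
  using taylor_cong_mod[of f] by (simp add: assms laurent_const_def)

end

definition cross_ideal :: "('i \<times> side, 'k::comm_ring_1) laurent set" where
  "cross_ideal = genideal ring_of_type_algebra cross_gens"

lemma cross_ideal_ideal: "ideal (cross_ideal :: ('i \<times> side, 'k::comm_ring_1) laurent set) ring_of_type_algebra"
  and cross_gens_subset: "cross_gens \<subseteq> (cross_ideal :: ('i \<times> side, 'k) laurent set)"
proof -
  interpret R: cring "ring_of_type_algebra :: ('i \<times> side, 'k) laurent ring"
    by (rule cring_from_type_algebra)
  show "ideal (cross_ideal :: ('i \<times> side, 'k) laurent set) ring_of_type_algebra"
    "cross_gens \<subseteq> (cross_ideal :: ('i \<times> side, 'k) laurent set)"
    unfolding cross_ideal_def by (simp_all add: R.genideal_ideal R.genideal_self)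
qed

text \<open>
  The initial ideal is cut out by \<open>2\<^sup>L\<close> linear functionals. One inclusion holds because their
  common kernel is an ideal containing the generators, the other by Taylor expansion.
\<close>

lemma mem_cross_ideal_iff:
  fixes f :: "('i::finite \<times> side, 'k::comm_ring_1) laurent"
  shows "f \<in> cross_ideal \<longleftrightarrow> (\<forall>S. jet S f = 0)"
proof
  interpret R: cring "ring_of_type_algebra :: ('i \<times> side, 'k) laurent ring"
    by (rule cring_from_type_algebra)
  have "cross_ideal \<subseteq> {f :: ('i \<times> side, 'k) laurent. \<forall>S\<in>UNIV. jet S f = 0}"
    unfolding cross_ideal_def
    by (rule R.genideal_minimal) (use ideal_jets[of UNIV] in \<open>auto simp: jet_cross_gens\<close>)
  thus "f \<in> cross_ideal \<Longrightarrow> \<forall>S. jet S f = 0" by auto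
qed (simp add: jets_zero_mem cross_ideal_ideal cross_gens_subset)

section \<open>Chains of ideals above the initial ideal\<close>

text \<open>
  Recording all jets embeds the quotient by the initial ideal into a vector space of dimension
  \<open>2\<^sup>L\<close>. Ideals are subspaces, so dimensions strictly increase along a chain of ideals.
\<close>

lemma cross_chain_length_le:
  assumes "is_ideal_chain ring_of_type_algebra
     (cross_ideal :: ('i::finite \<times> side, 'k::field) laurent set) n J"
  shows "n \<le> 2 ^ CARD('i)"
proof -
  define v :: "('i \<times> side, 'k) laurent \<Rightarrow> 'k ^ ('i set)" where "v f = (\<chi> S. jet S f)" for f
  from assms have J: "\<And>i. i \<le> n \<Longrightarrow> ideal (J i) ring_of_type_algebra"
    "\<And>i. i \<le> n \<Longrightarrow> cross_ideal \<subseteq> J i" "\<And>i. i < n \<Longrightarrow> J i \<subset> J (Suc i)"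
    by (auto simp: is_ideal_chain_def)
  have v_add: "v f + v g = v (f + g)" for f g
    by (simp add: v_def vec_eq_iff jet_add)
  have v_smult: "c *s v f = v (laurent_const c * f)" for c f
  proof -
    have "jet S (laurent_const c * f) = c * jet S f" for S
    proof -
      have "jet S (laurent_const c * f) = (\<Sum>T\<in>Pow S. if T = {} then c * jet S f else 0)"
        unfolding jet_mult by (rule sum.cong) (auto simp: jet_const)
      thus ?thesis by simp
    qed
    thus ?thesis by (simp add: v_def vec_eq_iff)
  qed
  have v_eq: "f - g \<in> cross_ideal" if "v f = v g" for f g
    using that by (simp add: v_def vec_eq_iff mem_cross_ideal_iff jet_minus)
  have sub: "vec.subspace (v ` J i)" if i: "i \<le> n" for i
  proof (rule vec.subspaceI)
    show "0 \<in> v ` J i"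
      using ideal_typeD(1)[OF J(1)[OF i]] by (intro image_eqI[of _ _ 0]) (simp_all add: v_def vec_eq_iff jet_zero)
  qed (use ideal_typeD(2,3)[OF J(1)[OF i]] in \<open>auto simp: v_add v_smult\<close>)
  have "i \<le> vec.dim (v ` J i)" if "i \<le> n" for i
    using that
  proof (induction i)
    case (Suc i)
    have "v ` J i \<noteq> v ` J (Suc i)"
    proof
      assume eq: "v ` J i = v ` J (Suc i)"
      have "f \<in> J i" if f: "f \<in> J (Suc i)" for f
      proof -
        from f have "v f \<in> v ` J i" unfolding eq by (rule imageI)
        then obtain g where "g \<in> J i" "v f = v g" by auto
        hence "g \<in> J i" "f - g \<in> J i" using v_eq J(2)[of i] Suc.prems by auto
        thus "f \<in> J i" using ideal_typeD(2)[OF J(1), of i g "f - g"] Suc.prems by simp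
      qed
      thus False using J(3)[of i] Suc.prems by auto
    qed
    moreover have "v ` J i \<subseteq> v ` J (Suc i)" using J(3)[of i] Suc.prems by auto
    ultimately have "vec.dim (v ` J i) < vec.dim (v ` J (Suc i))"
      using sub[of i] sub[of "Suc i"] Suc.prems
      by (intro vec.dim_psubset) (simp add: vec.span_eq_iff[THEN iffD2] psubset_eq)
    thus ?case using Suc by simp
  qed simp
  from this[of n] have "n \<le> vec.dim (v ` J n)" by simp
  also have "\<dots> \<le> CARD('i set)" by (rule dim_subset_UNIV_cart_gen)
  finally show ?thesis by simp
qed

text \<open>
  A chain attaining the bound kills fewer and fewer jets, one at a time. For its members to be
  ideals the surviving conditions must always form a family closed under subsets. Numbering the
  subsets by the binary code of their complement achieves this, since the code is monotone.
\<close>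

lemma cross_chain_exists:
  "\<exists>J. is_ideal_chain ring_of_type_algebra
     (cross_ideal :: ('i::finite \<times> side, 'k::field) laurent set) (2 ^ CARD('i)) J"
proof -
  obtain e :: "'i \<Rightarrow> nat" where e: "bij_betw e UNIV {0..<CARD('i)}"
    using ex_bij_betw_finite_nat[of "UNIV :: 'i set"] by auto
  define code where "code S = set_encode (e ` S)" for S
  have code_mono: "code S \<le> code T" if "S \<subseteq> T" for S T
    unfolding code_def set_encode_def using that by (intro sum_mono2) auto
  have code_surj: "\<exists>S. code (- S) = i" if i: "i < 2 ^ CARD('i)" for i
  proof -
    have "x < CARD('i)" if "x \<in> set_decode i" for x
    proof (rule ccontr)
      assume "\<not> x < CARD('i)"
      hence "i < 2 ^ x" using i power_increasing[of "CARD('i)" x "2::nat"] by linarith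
      thus False using that by (simp add: set_decode_def)
    qed
    hence "set_decode i \<subseteq> range e" using e by (auto simp: bij_betw_def)
    hence "e ` (e -` set_decode i) = set_decode i" by auto
    hence "code (- (- (e -` set_decode i))) = i" by (simp add: code_def)
    thus ?thesis by blast
  qed
  define J :: "nat \<Rightarrow> ('i \<times> side, 'k) laurent set"
    where "J i = {f. \<forall>S\<in>{S. i \<le> code (- S)}. jet S f = 0}" for i
  have "is_ideal_chain ring_of_type_algebra cross_ideal (2 ^ CARD('i)) J"
    unfolding is_ideal_chain_def
  proof (intro conjI allI impI)
    fix i
    show "ideal (J i) ring_of_type_algebra"
      unfolding J_def
    proof (rule ideal_jets)
      fix S T assume "S \<in> {S. i \<le> code (- S)}" "T \<subseteq> S"
      thus "T \<in> {S. i \<le> code (- S)}" using code_mono[of "- S" "- T"] by auto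
    qed
    show "cross_ideal \<subseteq> J i" by (auto simp: J_def mem_cross_ideal_iff)
  next
    fix i :: nat assume "i < 2 ^ CARD('i)"
    then obtain S where S: "code (- S) = i" using code_surj by blast
    \<comment> \<open>the squarefree monomial dual to the one jet that is dropped in this step\<close>
    let ?f = "\<Prod>k\<in>S. tangent k :: ('i \<times> side, 'k) laurent"
    have "?f \<in> J (Suc i)" "?f \<notin> J i"
      using S by (auto simp: J_def jet_prod_tangent)
    moreover have "J i \<subseteq> J (Suc i)" by (auto simp: J_def)
    ultimately show "J i \<subset> J (Suc i)" by blast
  qed
  thus ?thesis by blast
qed

section \<open>The local ring of the initial fiber\<close>

text \<open>
  A function vanishing at the base point has no term of degree \<open>0\<close> in the \<open>y\<^sub>k\<close>, so the lowest
  degree in its \<open>n\<close>-th power is at least \<open>n\<close>. In particular it is nilpotent modulo the initial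
  ideal.
\<close>

lemma jet_power_eq_0:
  fixes f :: "('i::finite \<times> side, 'k::comm_ring_1) laurent"
  assumes "jet {} f = 0" "card S < n"
  shows "jet S (f ^ n) = 0"
  using assms(2)
proof (induction n arbitrary: S)
  case (Suc n)
  have "jet T f * jet (S - T) (f ^ n) = 0" if "T \<subseteq> S" for T
  proof (cases "T = {}")
    case False
    have "card (S - T) < card S"
      using that False by (intro psubset_card_mono) auto
    thus ?thesis using Suc by simp
  qed (simp add: assms)
  thus ?case by (auto simp: jet_mult intro: sum.neutral)
qed simp

text \<open>
  After rescaling, \<open>f\<close> is \<open>1\<close> minus a nilpotent, and the finite geometric series inverts it.
\<close>

lemma unit_mod_cross_ideal:
  fixes f :: "('i::finite \<times> side, 'k::field) laurent"
  assumes "jet {} f \<noteq> 0"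
  shows "\<exists>g. f * g - 1 \<in> cross_ideal"
proof -
  define c where "c = laurent_const (inverse (jet {} f)) * f"
  have "jet {} (1 - c) = 0"
    using assms by (simp add: c_def jet_minus jet_one jet_mult jet_const)
  hence "jet S ((1 - c) ^ Suc CARD('i)) = 0" for S
    by (rule jet_power_eq_0) (simp add: card_mono le_imp_less_Suc)
  moreover define p where "p = (1 - c) ^ Suc CARD('i)"
  ultimately have "p \<in> cross_ideal" by (simp add: mem_cross_ideal_iff)
  moreover define q where "q = (\<Sum>i<Suc CARD('i). (1 - c) ^ i)"
  have "1 - p = c * q"
    unfolding p_def q_def using one_diff_power_eq[of "1 - c" "Suc CARD('i)"] by simp
  hence "c * q - 1 = 0 - p" by (simp add: algebra_simps)
  ultimately have "c * q - 1 \<in> cross_ideal"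
    using ideal_typeD(4)[OF cross_ideal_ideal ideal_typeD(1)[OF cross_ideal_ideal]] by simp
  moreover have "c * q = f * (laurent_const (inverse (jet {} f)) * q)"
    by (simp add: c_def mult_ac)
  ultimately show ?thesis by metis
qed

definition cross_ring :: "('i \<times> side, 'k::comm_ring_1) laurent set ring" where
  "cross_ring = ring_of_type_algebra Quot cross_ideal"

definition cross_class :: "('i \<times> side, 'k::comm_ring_1) laurent \<Rightarrow> ('i \<times> side, 'k) laurent set" where
  "cross_class f = cross_ideal +>\<^bsub>ring_of_type_algebra\<^esub> f"

text \<open>
  The functional \<open>jet {}\<close> is evaluation at \<open>(1, \<dots>, 1)\<close>, so this is the maximal ideal of that point.
\<close>

definition base_point :: "('i \<times> side, 'k::comm_ring_1) laurent set set" where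
  "base_point = cross_class ` {f. jet {} f = 0}"

lemma cross_ring_cring: "cring (cross_ring :: ('i \<times> side, 'k::comm_ring_1) laurent set ring)"
  unfolding cross_ring_def
  by (rule ideal.quotient_is_cring[OF cross_ideal_ideal cring_from_type_algebra])

lemma cross_class_hom:
  "ring_hom_ring ring_of_type_algebra
     (cross_ring :: ('i \<times> side, 'k::comm_ring_1) laurent set ring) cross_class"
  using ideal.rcos_ring_hom_ring[OF cross_ideal_ideal]
  by (simp add: cross_ring_def cross_class_def[abs_def])

lemma carrier_cross_ring:
  "carrier (cross_ring :: ('i \<times> side, 'k::comm_ring_1) laurent set ring) = range cross_class"
  by (auto simp: cross_ring_def cross_class_def FactRing_def A_RCOSETS_def')

lemma cross_class_eq_iff:
  fixes f g :: "('i \<times> side, 'k::comm_ring_1) laurent"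
  shows "cross_class f = cross_class g \<longleftrightarrow> f - g \<in> cross_ideal"
proof -
  interpret R: cring "ring_of_type_algebra :: ('i \<times> side, 'k) laurent ring"
    by (rule cring_from_type_algebra)
  have "f \<ominus>\<^bsub>ring_of_type_algebra\<^esub> g = f - g"
    by (simp add: a_minus_def ring_of_type_algebra_uminus)
  thus ?thesis
    using R.quotient_eq_iff_same_a_r_cos[OF cross_ideal_ideal, of f g] by (simp add: cross_class_def)
qed

lemma cross_class_simps:
  fixes f g :: "('i \<times> side, 'k::comm_ring_1) laurent"
  shows "cross_class f \<otimes>\<^bsub>cross_ring\<^esub> cross_class g = cross_class (f * g)"
    and "\<one>\<^bsub>cross_ring\<^esub> = cross_class (1 :: ('i \<times> side, 'k) laurent)"
    and "\<zero>\<^bsub>cross_ring\<^esub> = cross_class (0 :: ('i \<times> side, 'k) laurent)"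
proof -
  interpret q: ring_hom_ring ring_of_type_algebra
    "cross_ring :: ('i \<times> side, 'k) laurent set ring" cross_class by (rule cross_class_hom)
  show "cross_class f \<otimes>\<^bsub>cross_ring\<^esub> cross_class g = cross_class (f * g)"
    "\<one>\<^bsub>cross_ring\<^esub> = cross_class (1 :: ('i \<times> side, 'k) laurent)"
    "\<zero>\<^bsub>cross_ring\<^esub> = cross_class (0 :: ('i \<times> side, 'k) laurent)"
    using q.hom_mult[of f g] q.hom_one q.hom_zero by (simp_all only: ring_of_type_algebra_simps UNIV_I)
qed

lemma cross_class_mem_base_point:
  fixes f :: "('i::finite \<times> side, 'k::comm_ring_1) laurent"
  shows "cross_class f \<in> base_point \<longleftrightarrow> jet {} f = 0"
  by (auto simp: base_point_def cross_class_eq_iff mem_cross_ideal_iff jet_minus)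

lemma base_point_complement_units:
  "carrier cross_ring - base_point
     \<subseteq> Units (cross_ring :: ('i::finite \<times> side, 'k::field) laurent set ring)"
proof
  interpret A: cring "cross_ring :: ('i \<times> side, 'k) laurent set ring" by (rule cross_ring_cring)
  fix a :: "('i \<times> side, 'k) laurent set" assume a: "a \<in> carrier cross_ring - base_point"
  then obtain f where f: "a = cross_class f" by (auto simp: carrier_cross_ring)
  with a have "jet {} f \<noteq> 0" by (simp add: cross_class_mem_base_point)
  then obtain g where "f * g - 1 \<in> cross_ideal" using unit_mod_cross_ideal by blast
  hence inv: "cross_class f \<otimes>\<^bsub>cross_ring\<^esub> cross_class g = \<one>\<^bsub>cross_ring\<^esub>"
    by (simp add: cross_class_simps cross_class_eq_iff)
  have carr: "cross_class f \<in> carrier cross_ring" "cross_class g \<in> carrier cross_ring"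
    by (simp_all add: carrier_cross_ring)
  have "cross_class g \<otimes>\<^bsub>cross_ring\<^esub> cross_class f = \<one>\<^bsub>cross_ring\<^esub>"
    using inv A.m_comm[OF carr] by simp
  with inv carr show "a \<in> Units cross_ring" unfolding f Units_def by blast
qed

lemma base_point_prime:
  "primeideal base_point (cross_ring :: ('i::finite \<times> side, 'k::field) laurent set ring)"
proof (rule primeidealI)
  have "ideal {f :: ('i \<times> side, 'k) laurent. \<forall>S\<in>{{}}. jet S f = 0} ring_of_type_algebra"
    by (rule ideal_jets) auto
  hence "ideal {f :: ('i \<times> side, 'k) laurent. jet {} f = 0} ring_of_type_algebra" by simp
  thus "ideal base_point (cross_ring :: ('i \<times> side, 'k) laurent set ring)"
    unfolding base_point_def
    by (intro ideal_image_surj[OF cross_class_hom]) (simp_all add: carrier_cross_ring)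
  show "carrier (cross_ring :: ('i \<times> side, 'k) laurent set ring) \<noteq> base_point"
    using cross_class_mem_base_point[of "1 :: ('i \<times> side, 'k) laurent"]
    by (auto simp: carrier_cross_ring jet_one)
next
  fix a b :: "('i \<times> side, 'k) laurent set"
  assume ab: "a \<in> carrier cross_ring" "b \<in> carrier cross_ring" "a \<otimes>\<^bsub>cross_ring\<^esub> b \<in> base_point"
  then obtain f g where fg: "a = cross_class f" "b = cross_class g"
    by (auto simp: carrier_cross_ring)
  with ab have "jet {} (f * g) = 0"
    by (simp only: cross_class_simps cross_class_mem_base_point)
  thus "a \<in> base_point \<or> b \<in> base_point"
    by (simp add: fg cross_class_mem_base_point jet_mult)
qed (rule cross_ring_cring)

text \<open>
  A prime ideal contains each \<open>y\<^sub>k\<close> because it contains \<open>y\<^sub>k\<^sup>2\<close>. By Taylor expansion every function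
  is then congruent to its value at the base point, so the prime contains all functions vanishing
  there, and it cannot contain any other function without containing a unit.
\<close>

lemma prime_eq_base_point:
  assumes P: "primeideal P (cross_ring :: ('i::finite \<times> side, 'k::field) laurent set ring)"
  shows "P = base_point"
proof -
  interpret P: primeideal P cross_ring by (rule P)
  define Q where "Q = {f. cross_class f \<in> P}"
  have Q: "primeideal Q ring_of_type_algebra"
    using ring_hom_ring.primeideal_vimage[OF cross_class_hom cring_from_type_algebra P]
    by (simp add: Q_def)
  interpret Q: primeideal Q ring_of_type_algebra by (rule Q)
  have J: "ideal Q ring_of_type_algebra" by (rule Q.is_ideal)
  have "cross_ideal \<subseteq> Q"
  proof
    fix f :: "('i \<times> side, 'k) laurent" assume "f \<in> cross_ideal"
    hence "cross_class f = \<zero>\<^bsub>cross_ring\<^esub>" by (simp add: cross_class_simps cross_class_eq_iff)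
    moreover have "\<zero>\<^bsub>cross_ring\<^esub> \<in> P"
      by (rule additive_subgroup.zero_closed[OF P.additive_subgroup_axioms])
    ultimately show "f \<in> Q" by (simp add: Q_def)
  qed
  hence gens: "cross_gens \<subseteq> Q" using cross_gens_subset by blast
  have tangent: "tangent k \<in> Q" for k
    using tangent_square_mem[OF J gens, of k] Q.I_prime[of "tangent k" "tangent k"] by simp
  have const: "f - laurent_const (jet {} f) \<in> Q" for f
  proof -
    have "laurent_const (jet S f) * (\<Prod>k\<in>S. tangent k) \<in> Q" if "S \<noteq> {}" for S
    proof -
      from that obtain k where k: "k \<in> S" by blast
      have "laurent_const (jet S f) * (\<Prod>k\<in>S. tangent k)
          = (laurent_const (jet S f) * (\<Prod>k\<in>S - {k}. tangent k)) * tangent k"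
        by (simp add: prod.remove[OF finite k] mult_ac)
      also have "\<dots> \<in> Q" by (rule ideal_typeD(3)[OF J tangent])
      finally show ?thesis .
    qed
    hence "(\<Sum>S\<in>UNIV - {{}}. laurent_const (jet S f) * (\<Prod>k\<in>S. tangent k)) \<in> Q"
      by (intro sum_mem_ideal[OF J]) simp
    hence "(f - (\<Sum>S\<in>UNIV. laurent_const (jet S f) * (\<Prod>k\<in>S. tangent k)))
        + (\<Sum>S\<in>UNIV - {{}}. laurent_const (jet S f) * (\<Prod>k\<in>S. tangent k)) \<in> Q"
      by (rule ideal_typeD(2)[OF J taylor_cong_mod[OF J gens]])
    thus ?thesis by (simp add: sum.remove[of UNIV "{}"])
  qed
  have "jet {} f = 0" if "f \<in> Q" for f
  proof (rule ccontr)
    assume nz: "jet {} f \<noteq> 0"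
    have "laurent_const (jet {} f) \<in> Q"
      using ideal_typeD(4)[OF J that const[of f]] by simp
    hence "laurent_const (inverse (jet {} f)) * laurent_const (jet {} f) \<in> Q"
      by (rule ideal_typeD(3)[OF J])
    moreover have "laurent_const (inverse (jet {} f)) * laurent_const (jet {} f)
        = \<one>\<^bsub>ring_of_type_algebra :: ('i \<times> side, 'k) laurent ring\<^esub>"
      using nz by (simp add: laurent_const_def mult_single)
    ultimately show False using Q.one_imp_carrier Q.I_notcarr by metis
  qed
  moreover have "f \<in> Q" if "jet {} f = 0" for f
    using const[of f] that by (simp add: laurent_const_def)
  ultimately have "cross_class f \<in> P \<longleftrightarrow> cross_class f \<in> base_point" for f
    unfolding cross_class_mem_base_point Q_def by blast
  moreover have "P \<subseteq> range cross_class"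
    using P.Icarr unfolding carrier_cross_ring by blast
  moreover have "base_point \<subseteq> range cross_class" by (auto simp: base_point_def)
  ultimately show ?thesis by blast
qed

lemma ring_length_cross_ring:
  "ring_length (cross_ring :: ('i::finite \<times> side, 'k::field) laurent set ring) = 2 ^ CARD('i)"
proof -
  let ?R = "ring_of_type_algebra :: ('i \<times> side, 'k) laurent ring"
  let ?I = "cross_ideal :: ('i \<times> side, 'k) laurent set"
  have ker: "a_kernel ?R cross_ring cross_class = ?I"
    using a_kernel_quotient[OF cross_ideal_ideal]
    by (simp add: cross_ring_def cross_class_def[abs_def])
  have "ring_length (cross_ring :: ('i \<times> side, 'k) laurent set ring)
      = (SUP n \<in> {n. \<exists>J. is_ideal_chain ?R ?I n J}. enat n)"
    using ring_length_surj[OF cross_class_hom[where ?'i = 'i and ?'k = 'k]]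
    by (simp add: ker carrier_cross_ring)
  also have "\<dots> = enat (2 ^ CARD('i))"
  proof (rule antisym)
    show "(SUP n \<in> {n. \<exists>J. is_ideal_chain ?R ?I n J}. enat n) \<le> enat (2 ^ CARD('i))"
      by (rule SUP_least) (auto dest: cross_chain_length_le)
    show "enat (2 ^ CARD('i)) \<le> (SUP n \<in> {n. \<exists>J. is_ideal_chain ?R ?I n J}. enat n)"
      by (rule SUP_upper) (use cross_chain_exists in blast)
  qed
  also have "\<dots> = 2 ^ CARD('i)"
    by (metis of_nat_eq_enat of_nat_numeral of_nat_power)
  finally show ?thesis .
qed

text \<open>
  Only the initial forms of the generators enter the initial fiber, so the computation applies to
  every system with these initial forms.
\<close>

lemma init_fiber_cross:
  fixes F :: "('i::finite \<times> side, 'k::field puiseux) laurent set"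
  assumes F: "init_form ` F = cross_gens"
  shows "ring_spec (init_fiber_ring F) = {init_fiber_point F (\<lambda>_. 1)}"
    and "init_fiber_length_at F (\<lambda>_. 1) = 2 ^ CARD('i)"
proof -
  have eval: "laurent_eval f (\<lambda>_. 1) = jet {} f" for f :: "('i \<times> side, 'k) laurent"
    by (simp add: laurent_eval_eq_weighted_sum jet_def)
  have ideal: "init_fiber_ideal F = cross_ideal"
    by (simp add: init_fiber_ideal_def F cross_ideal_def)
  have ring: "init_fiber_ring F = cross_ring"
    by (simp add: init_fiber_ring_def ideal cross_ring_def)
  have point: "init_fiber_point F (\<lambda>_. 1) = base_point"
    by (simp add: init_fiber_point_def ideal eval base_point_def cross_class_def[abs_def])
  show "ring_spec (init_fiber_ring F) = {init_fiber_point F (\<lambda>_. 1)}"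
    unfolding ring point ring_spec_def using base_point_prime prime_eq_base_point by blast
  show "init_fiber_length_at F (\<lambda>_. 1) = 2 ^ CARD('i)"
    unfolding init_fiber_length_at_def ring point
      ring_length_localization_at_units[OF cross_ring_cring base_point_complement_units base_point_prime]
    by (rule ring_length_cross_ring)
qed

section \<open>The cross-prism collision\<close>

theorem proposition6p2:
  fixes lam s :: "'l::nontriv mod_ring \<Rightarrow> complex" and \<beta> :: rat
  assumes "\<beta> > 0"
    and "\<And>k. lam k \<noteq> 0"
    and "\<And>k. s k ^ 2 = lam k"
  shows "torus_zeros (prism_system lam \<beta>) = {prism_branch s \<beta> \<epsilon> | \<epsilon>. \<forall>k. \<epsilon> k \<in> {1, -1}}
    \<and> card (torus_zeros (prism_system lam \<beta>)) = 2 ^ CARD('l)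
    \<and> (\<forall>x \<in> torus_zeros (prism_system lam \<beta>). val_vector x = (\<lambda>_. 0) \<and> lc_vector x = (\<lambda>_. 1))
    \<and> torus_zeros (init_form ` prism_system lam \<beta>) = {\<lambda>_. 1}
    \<and> ring_spec (init_fiber_ring (prism_system lam \<beta>))
        = {init_fiber_point (prism_system lam \<beta>) (\<lambda>_. 1)}
    \<and> init_fiber_length_at (prism_system lam \<beta>) (\<lambda>_. 1) = 2 ^ CARD('l)
    \<and> cluster_mult (prism_system lam \<beta>) (\<lambda>_. 0) = 2 ^ CARD('l)"
proof (intro conjI)
  have "s k \<noteq> 0" for k
    using assms(2)[of k] assms(3)[of k] by auto
  hence card: "card {prism_branch s \<beta> \<epsilon> | \<epsilon>. \<forall>k. \<epsilon> k \<in> {1, -1}} = 2 ^ CARD('l)"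
    by (rule card_prism_branches)
  note zeros = torus_zeros_prism_system[OF assms(1,3)]
  note init = init_form_prism_system[OF assms(1), of lam]
  show "torus_zeros (prism_system lam \<beta>) = {prism_branch s \<beta> \<epsilon> | \<epsilon>. \<forall>k. \<epsilon> k \<in> {1, -1}}"
    by (rule zeros)
  show "card (torus_zeros (prism_system lam \<beta>)) = 2 ^ CARD('l)"
    by (simp only: zeros card)
  show val: "\<forall>x \<in> torus_zeros (prism_system lam \<beta>). val_vector x = (\<lambda>_. 0) \<and> lc_vector x = (\<lambda>_. 1)"
    unfolding zeros using prism_branch_val_lc[OF assms(1), of s] by blast
  hence "{x \<in> torus_zeros (prism_system lam \<beta>). val_vector x = (\<lambda>_. 0)} = torus_zeros (prism_system lam \<beta>)"
    by blast
  thus "cluster_mult (prism_system lam \<beta>) (\<lambda>_. 0) = 2 ^ CARD('l)"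
    by (simp only: cluster_mult_def zeros card)
  show "torus_zeros (init_form ` prism_system lam \<beta>) = {\<lambda>_. 1}"
    by (simp only: init torus_zeros_cross_gens)
  show "ring_spec (init_fiber_ring (prism_system lam \<beta>))
      = {init_fiber_point (prism_system lam \<beta>) (\<lambda>_. 1)}"
    by (rule init_fiber_cross(1)[OF init])
  show "init_fiber_length_at (prism_system lam \<beta>) (\<lambda>_. 1) = 2 ^ CARD('l)"
    using init_fiber_cross(2)[OF init] by simp
qed

end
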